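(* Consider a solution $(\mathbf V,\varrho,p,S)$ of the Cauchy problem for the compressible Euler system $$\partial_t(\varrho\mathbf V)+\mathrm{div}_{\mathbf x}(\varrho\mathbf V\otimes\mathbf V)+\nabla_{\mathbf x}p=0,\quad \partial_t\varrho+\mathrm{div}_{\mathbf x}(\varrho\mathbf V)=0,\quad \partial_tS+\mathbf V\cdot\nabla_{\mathbf x}S=0,\quad p=e^S\varrho^\gamma$$ with $C^1$ initial data $(\mathbf V,\varrho,p)|_{t=0}=(\mathbf V_0,\varrho_0,p_0)(\mathbf x)$, $\varrho_0\ge0$, $p_0\ge0$, and with finite total energy $\mathcal E$. The solution cannot keep its initial smoothness for all $t>0$ if $$\lim_{R\to\infty}R^n\sup_{t\ge 0,\ |\mathbf x|=R}\left[\frac{\delta}{R}\int_0^t\left(\frac12\varrho|\mathbf V|^2+\frac{\gamma}{\gamma-1}p\right)|\mathbf V|\,d\tau+\left(\varrho|\mathbf V|^2+np\right)\right]\le\delta_1\mathcal E$$ for some constant $\delta_1$ with $0\le\delta_1<\dfrac{\delta}{n\omega_n}$. (In the bracket, the integrand is evaluated at $(\mathbf x,\tau)$ and the last term at $(\mathbf x,t)$.)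
   Context: Unknowns: density $\varrho(\mathbf x,t)$, velocity $\mathbf V(\mathbf x,t)\in\mathbb R^n$, pressure $p(\mathbf x,t)$, entropy $S(\mathbf x,t)$, with $\mathbf x\in\mathbb R^n$, $t\ge0$; $\gamma>1$ is a constant. "Keeping initial smoothness" means remaining a $C^1$ (classical) solution. The total energy is $$\mathcal E=\frac12\int_{\mathbb R^n}\varrho|\mathbf V|^2\,dx+\frac1{\gamma-1}\int_{\mathbb R^n}p\,dx=\mathrm{const}>0,$$ finite and constant in time. $\delta=\min\{2,n(\gamma-1)\}>0$, and $\omega_n$ is the volume of the unit ball in $\mathbb R^n$. *)

theory Defs
  imports "HOL-Analysis.Analysis"
begin

text \<open>
  Used below only for the whole space and for the closed half-space \<open>UNIV \<times> {0..}\<close>; on both the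
  derivative within \<open>D\<close> is unique, at the boundary \<open>t = 0\<close> it is one-sided in time.
\<close>

definition C1_on ::
    "'a::real_normed_vector set \<Rightarrow> ('a \<Rightarrow> 'b::real_normed_vector) \<Rightarrow> bool" where
  "C1_on D f \<longleftrightarrow>
     (\<exists>f'. (\<forall>z\<in>D. (f has_derivative blinfun_apply (f' z)) (at z within D)) \<and> continuous_on D f')"

definition gradient :: "(real^'n \<Rightarrow> real) \<Rightarrow> real^'n \<Rightarrow> real^'n" where
  "gradient f x = (\<chi> i. frechet_derivative f (at x) (axis i 1))"

definition divergence :: "(real^'n \<Rightarrow> real^'n) \<Rightarrow> real^'n \<Rightarrow> real" where
  "divergence F x = (\<Sum>i\<in>UNIV. frechet_derivative F (at x) (axis i 1) $ i)"

text \<open>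
  Classical solutions on \<open>[0,\<infinity>)\<close>: velocity, density and pressure are \<open>C\<^sup>1\<close> up to the initial time.
  The entropy is only asked to be differentiable, so that its transport equation holds in the
  classical sense; where \<open>\<rho> > 0\<close> the equation of state makes it \<open>C\<^sup>1\<close>. The density is
  nonnegative, as is implicit in the term \<open>\<rho>\<close> to the power \<open>\<gamma>\<close>. The \<open>i\<close>-th component
  of the divergence of \<open>\<rho>V \<otimes> V\<close> is the divergence of the vector field \<open>\<rho>V\<^sub>iV\<close>.
\<close>

definition global_classical_euler_solution ::
    "real \<Rightarrow> (real^'n \<Rightarrow> real \<Rightarrow> real^'n) \<Rightarrow> (real^'n \<Rightarrow> real \<Rightarrow> real) \<Rightarrow>
     (real^'n \<Rightarrow> real \<Rightarrow> real) \<Rightarrow> (real^'n \<Rightarrow> real \<Rightarrow> real) \<Rightarrow> bool" where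
  "global_classical_euler_solution \<gamma> V \<rho> p S \<longleftrightarrow>
     C1_on (UNIV \<times> {0..}) (\<lambda>(x, t). V x t) \<and>
     C1_on (UNIV \<times> {0..}) (\<lambda>(x, t). \<rho> x t) \<and>
     C1_on (UNIV \<times> {0..}) (\<lambda>(x, t). p x t) \<and>
     (\<forall>x. \<forall>t\<ge>0. \<rho> x t \<ge> 0 \<and> p x t = exp (S x t) * \<rho> x t powr \<gamma>) \<and>
     (\<forall>x. \<forall>t>0.
        vector_derivative (\<lambda>s. \<rho> x s *\<^sub>R V x s) (at t)
          + (\<chi> i. divergence (\<lambda>y. (\<rho> y t * V y t $ i) *\<^sub>R V y t) x)
          + gradient (\<lambda>y. p y t) x = 0 \<and>
        deriv (\<lambda>s. \<rho> x s) t + divergence (\<lambda>y. \<rho> y t *\<^sub>R V y t) x = 0 \<and>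
        (\<lambda>(y, s). S y s) differentiable (at (x, t)) \<and>
        deriv (\<lambda>s. S x s) t + V x t \<bullet> gradient (\<lambda>y. S y t) x = 0)"

definition total_energy ::
    "real \<Rightarrow> (real^'n \<Rightarrow> real \<Rightarrow> real^'n) \<Rightarrow> (real^'n \<Rightarrow> real \<Rightarrow> real) \<Rightarrow>
     (real^'n \<Rightarrow> real \<Rightarrow> real) \<Rightarrow> real \<Rightarrow> real" where
  "total_energy \<gamma> V \<rho> p t =
     1/2 * (\<integral>x. \<rho> x t * (norm (V x t))\<^sup>2 \<partial>lborel) + 1 / (\<gamma> - 1) * (\<integral>x. p x t \<partial>lborel)"

definition finite_energy ::
    "(real^'n \<Rightarrow> real \<Rightarrow> real^'n) \<Rightarrow> (real^'n \<Rightarrow> real \<Rightarrow> real) \<Rightarrow>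
     (real^'n \<Rightarrow> real \<Rightarrow> real) \<Rightarrow> real \<Rightarrow> bool" where
  "finite_energy V \<rho> p t \<longleftrightarrow>
     integrable lborel (\<lambda>x. \<rho> x t * (norm (V x t))\<^sup>2) \<and> integrable lborel (\<lambda>x. p x t)"

end

theory Submission
  imports Defs
begin

text \<open>
  The proof plays the energy against a second moment of the density. Formally, on a ball of radius
  \<open>R\<close>, put \<open>H = \<integral> \<rho> (R\<^sup>2 - |x|\<^sup>2) / 2\<close> and \<open>J = \<integral> \<rho> V \<bullet> x\<close>. The continuity equation
  gives \<open>H' = - J\<close> without a boundary term, because the weight vanishes on the sphere. The virial
  identity gives \<open>J' = \<integral> (\<rho>|V|\<^sup>2 + n p)\<close> minus the momentum flux through the sphere. The
  integrand is at least \<open>\<delta>\<close> times the energy density, and the energy inside the ball falls below its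
  initial value by at most the time integral of the enthalpy flux \<open>(\<rho>|V|\<^sup>2 / 2 + \<gamma> p / (\<gamma> - 1)) V\<close>.
  The decay hypothesis combines precisely these two boundary contributions: multiplied by
  the area \<open>n \<omega> R ^ (n - 1)\<close> of the sphere they amount to at most \<open>n \<omega> M\<close> uniformly in time, for
  any \<open>M > \<delta>\<^sub>1 E\<close> and large \<open>R\<close>. As \<open>n \<omega> \<delta>\<^sub>1 < \<delta>\<close> and the initial energy in the ball
  tends to \<open>E\<close>, for large \<open>R\<close> one gets \<open>J' \<ge> c > 0\<close> for all times. Then \<open>H\<close> is bounded above by a
  concave quadratic function of time and becomes negative, although \<open>\<rho> \<ge> 0\<close>.

  Surface integrals are avoided by averaging over the radius. The ball is replaced by a radial
  Lipschitz cutoff that drops from \<open>1\<close> to \<open>0\<close> over an annulus, linearly in \<open>|x| ^ n\<close>, so that the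
  integral of the size of its gradient times \<open>|x| ^ (1 - n)\<close> is exactly \<open>n \<omega>\<close>
  (\<open>integral_radial_annulus\<close>). The weight
  \<open>(R\<^sup>2 - |x|\<^sup>2) / 2\<close> becomes the potential whose gradient is \<open>- x\<close> times the cutoff
  (\<open>lipschitz_cutoff_potential\<close>). The divergence theorem for such cutoffs
  (\<open>lipschitz_cutoff_divergence\<close>) and Fubini in time turn each pointwise law into an integrated one
  (\<open>cutoff_conservation_law\<close>), which is applied to mass, energy and virial. The
  contradiction for a fixed annulus is \<open>euler_cutoff_estimate\<close>.
\<close>

section \<open>Integrals against compactly supported weights\<close>

lemma integrable_cutoff_mult:
  fixes w f :: "'a::euclidean_space \<Rightarrow> real"
  assumes w[measurable]: "w \<in> borel_measurable borel" and bd: "\<And>x. \<bar>w x\<bar> \<le> C"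
    and supp: "\<And>x. norm x \<ge> B \<Longrightarrow> w x = 0" and f: "continuous_on UNIV f"
  shows "integrable lborel (\<lambda>x. w x * f x)"
proof (rule Bochner_Integration.integrable_bound)
  have [measurable]: "f \<in> borel_measurable borel"
    using f by (rule borel_measurable_continuous_onI)
  have "continuous_on (cball 0 B) (\<lambda>x. norm (f x))"
    using f by (intro continuous_intros) (auto intro: continuous_on_subset)
  then show "integrable lborel (\<lambda>x. C * (indicator (cball 0 B) x *\<^sub>R norm (f x)))"
    by (intro integrable_mult_right borel_integrable_compact) auto
  show "(\<lambda>x. w x * f x) \<in> borel_measurable lborel" by simp
  have C: "C \<ge> 0" using bd[of 0] by linarith
  show "AE x in lborel. norm (w x * f x) \<le> norm (C * (indicator (cball 0 B) x *\<^sub>R norm (f x)))"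
  proof (rule AE_I2)
    fix x
    show "norm (w x * f x) \<le> norm (C * (indicator (cball 0 B) x *\<^sub>R norm (f x)))"
      using bd[of x] supp[of x] C
      by (cases "norm x \<le> B") (auto simp: abs_mult indicator_def intro!: mult_right_mono)
  qed
qed

lemma continuous_on_slice:
  assumes "continuous_on (UNIV \<times> {0..}) (\<lambda>(x, t). h x t)" "t \<ge> (0::real)"
  shows "continuous_on UNIV (\<lambda>x. h x t)"
proof -
  have "continuous_on UNIV ((\<lambda>(x, t). h x t) \<circ> (\<lambda>x. (x, t)))"
    using assms by (intro continuous_on_compose continuous_intros) (auto intro: continuous_on_subset)
  then show ?thesis by (simp add: o_def)
qed

lemma continuous_on_time_slice:
  assumes "continuous_on (UNIV \<times> {0..}) (\<lambda>(x, t). h x t)"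
  shows "continuous_on {0::real..} (h x)"
proof -
  have "continuous_on {0..} ((\<lambda>(x, t). h x t) \<circ> (\<lambda>t. (x, t)))"
    using assms by (intro continuous_on_compose continuous_intros) (auto intro: continuous_on_subset)
  then show ?thesis by (simp add: o_def)
qed

text \<open>
  All time dependence is handled in integrated form, which replaces differentiation under the
  integral sign by this exchange of integrals. The weight \<open>w\<close> may be discontinuous: it will be the
  size of the gradient of a cutoff with kinks, which is why Fubini is applied to bounded measurable
  weights and not to continuous functions on a box.
\<close>

lemma cutoff_integral_time_swap:
  fixes w :: "'a::euclidean_space \<Rightarrow> real" and h :: "'a \<Rightarrow> real \<Rightarrow> real"
  assumes w[measurable]: "w \<in> borel_measurable borel" and bd: "\<And>x. \<bar>w x\<bar> \<le> C"
    and supp: "\<And>x. norm x \<ge> B \<Longrightarrow> w x = 0"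
    and h: "continuous_on (UNIV \<times> {0..}) (\<lambda>(x, t). h x t)"
  shows "integrable lborel (\<lambda>x. w x * integral {0..t} (h x))"
    and "((\<lambda>\<tau>. \<integral>x. w x * h x \<tau> \<partial>lborel) has_integral
            (\<integral>x. w x * integral {0..t} (h x) \<partial>lborel)) {0..t}"
proof -
  define S where "S = cball (0::'a) B \<times> {0..t}"
  define k where "k = (\<lambda>x \<tau>. w x * (indicator S (x, \<tau>) * h x \<tau>))"
  have "compact S" unfolding S_def by (intro compact_Times) auto
  moreover have "continuous_on S (\<lambda>(x, t). h x t)"
    by (rule continuous_on_subset[OF h]) (auto simp: S_def)
  ultimately have i1: "integrable lborel (\<lambda>z. indicator S z *\<^sub>R (case z of (x, t) \<Rightarrow> h x t))"
    by (rule borel_integrable_compact)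
  then have [measurable]: "(\<lambda>z. indicator S z * (case z of (x, t) \<Rightarrow> h x t)) \<in> borel_measurable borel"
    by simp
  have [measurable]: "(\<lambda>z::'a \<times> real. w (fst z)) \<in> borel_measurable borel"
    using measurable_comp[OF borel_measurable_continuous_onI[OF continuous_on_fst[OF continuous_on_id]] w]
    by (simp add: o_def)
  have "integrable lborel (\<lambda>z. w (fst z) * (indicator S z * (case z of (x, t) \<Rightarrow> h x t)))"
  proof (rule Bochner_Integration.integrable_bound)
    show "integrable lborel (\<lambda>z. C * norm (indicator S z *\<^sub>R (case z of (x, t) \<Rightarrow> h x t)))"
      using i1 by (intro integrable_mult_right integrable_norm)
    have C: "C \<ge> 0" using bd[of 0] by linarith
    show "AE z in lborel. norm (w (fst z) * (indicator S z * (case z of (x, t) \<Rightarrow> h x t)))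
        \<le> norm (C * norm (indicator S z *\<^sub>R (case z of (x, t) \<Rightarrow> h x t)))"
      by (rule AE_I2) (use bd C in \<open>auto simp: abs_mult intro!: mult_right_mono\<close>)
  qed measurable
  then have ik: "integrable (lborel \<Otimes>\<^sub>M lborel) (\<lambda>(x, \<tau>). k x \<tau>)"
    unfolding lborel_prod k_def by (simp add: split_def)
  have inner: "(\<integral>\<tau>. k x \<tau> \<partial>lborel) = w x * integral {0..t} (h x)" for x
  proof (cases "norm x < B")
    case True
    have "continuous_on {0..t} (h x)"
      by (rule continuous_on_subset[OF continuous_on_time_slice[OF h]]) auto
    then have "set_integrable lborel {0..t} (h x)"
      unfolding set_integrable_def by (rule borel_integrable_compact[rotated]) auto
    from set_borel_integral_eq_integral(2)[OF this]
    have "(\<integral>\<tau>. indicator {0..t} \<tau> * h x \<tau> \<partial>lborel) = integral {0..t} (h x)"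
      by (simp add: set_lebesgue_integral_def)
    moreover have "k x \<tau> = w x * (indicator {0..t} \<tau> * h x \<tau>)" for \<tau>
      using True by (auto simp: k_def S_def indicator_def)
    ultimately show ?thesis by simp
  next
    case False
    then show ?thesis by (simp add: k_def supp)
  qed
  have outer: "(\<integral>x. k x \<tau> \<partial>lborel) = indicator {0..t} \<tau> *\<^sub>R (\<integral>x. w x * h x \<tau> \<partial>lborel)" for \<tau>
  proof -
    have "k x \<tau> = indicator {0..t} \<tau> * (w x * h x \<tau>)" for x
      using supp[of x] by (cases "norm x \<le> B") (auto simp: k_def S_def indicator_def)
    then show ?thesis by simp
  qed
  show "integrable lborel (\<lambda>x. w x * integral {0..t} (h x))"
    using lborel_pair.integrable_fst[OF ik] by (simp add: inner)
  have si: "set_integrable lborel {0..t} (\<lambda>\<tau>. \<integral>x. w x * h x \<tau> \<partial>lborel)"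
    unfolding set_integrable_def using lborel_pair.integrable_snd[OF ik] by (simp add: outer)
  have "(LINT \<tau>:{0..t}|lborel. \<integral>x. w x * h x \<tau> \<partial>lborel) = (\<integral>x. w x * integral {0..t} (h x) \<partial>lborel)"
    using lborel_pair.Fubini_integral[OF ik] by (simp add: inner outer set_lebesgue_integral_def)
  then show "((\<lambda>\<tau>. \<integral>x. w x * h x \<tau> \<partial>lborel) has_integral
            (\<integral>x. w x * integral {0..t} (h x) \<partial>lborel)) {0..t}"
    using set_borel_integral_eq_integral[OF si] by (simp add: has_integral_iff)
qed

section \<open>Integration by parts against Lipschitz cutoffs\<close>

text \<open>
  The integral of a difference quotient vanishes by translation invariance, and the difference
  quotients of a compactly supported Lipschitz function are dominated, so the integral of their
  limit vanishes too. This is integration by parts without iterated integrals, and it tolerates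
  kinks along a null set.
\<close>

lemma integral_directional_derivative_eq_0:
  fixes u d :: "'a::euclidean_space \<Rightarrow> real"
  assumes lip: "\<And>x y. x \<in> cball 0 (B + 1) \<Longrightarrow> y \<in> cball 0 (B + 1) \<Longrightarrow> \<bar>u x - u y\<bar> \<le> K * norm (x - y)"
    and supp: "\<And>x. norm x \<ge> B \<Longrightarrow> u x = 0" and u: "continuous_on UNIV u"
    and K: "0 \<le> K" and e: "norm e = 1" and d: "d \<in> borel_measurable borel"
    and der: "AE x in lborel. ((\<lambda>h. u (x + h *\<^sub>R e)) has_real_derivative d x) (at 0)"
  shows "(\<integral>x. d x \<partial>lborel) = 0"
proof -
  define h :: "nat \<Rightarrow> real" where "h k = 1 / real (Suc k)" for k
  have h: "0 < h k" "h k \<le> 1" for k by (auto simp: h_def)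
  have h0: "h \<longlonglongrightarrow> 0" unfolding h_def using LIMSEQ_inverse_real_of_nat by (simp add: inverse_eq_divide)
  define s where "s k x = (u (x + h k *\<^sub>R e) - u x) / h k" for k x
  have um: "u \<in> borel_measurable borel" using u by (rule borel_measurable_continuous_onI)
  have ui: "integrable lborel u"
  proof -
    have "integrable lborel (\<lambda>x. indicator (ball 0 B) x * u x)"
      by (rule integrable_cutoff_mult[where w = "indicator (ball 0 B)" and C = 1 and B = B, OF borel_measurable_indicator _ _ u])
        (auto simp: indicator_def)
    moreover have "(\<lambda>x. indicator (ball 0 B) x * u x) = u"
      using supp by (force simp: indicator_def)
    ultimately show ?thesis by simp
  qed
  have cs: "continuous_on UNIV (s k)" for k
    unfolding s_def using h[of k]
    by (intro continuous_intros continuous_on_compose2[OF u]) auto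
  have int0: "(\<integral>x. s k x \<partial>lborel) = 0" for k
  proof -
    have eq: "(\<integral>x. u (h k *\<^sub>R e + x) \<partial>lborel) = (\<integral>x. u x \<partial>lborel)"
      using integral_distr[of "(+) (h k *\<^sub>R e)" lborel borel u] um lborel_distr_plus[of "h k *\<^sub>R e"] by simp
    have "integrable (distr lborel borel ((+) (h k *\<^sub>R e))) u" using ui by (simp add: lborel_distr_plus)
    then have "integrable lborel (\<lambda>x. u (h k *\<^sub>R e + x))"
      by (subst (asm) integrable_distr_eq) (use um in auto)
    then have "(\<integral>x. u (h k *\<^sub>R e + x) - u x \<partial>lborel) = 0"
      using eq ui by simp
    then show ?thesis by (simp add: s_def add.commute[of _ "h k *\<^sub>R e"])
  qed
  have "(\<lambda>k. \<integral>x. s k x \<partial>lborel) \<longlonglongrightarrow> (\<integral>x. d x \<partial>lborel)"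
  proof (rule integral_dominated_convergence)
    show "d \<in> borel_measurable lborel" using d by simp
    show "s k \<in> borel_measurable lborel" for k
      using borel_measurable_continuous_onI[OF cs] by simp
    show "integrable lborel (\<lambda>x::'a. K * indicator (cball 0 (B + 1)) x)"
      using emeasure_bounded_finite[of "cball (0::'a) (B + 1)"]
      by (intro integrable_mult_right integrable_real_indicator) (simp_all add: top.not_eq_extremum)
    show "AE x in lborel. norm (s k x) \<le> K * indicator (cball 0 (B + 1)) x" for k
    proof (rule AE_I2)
      fix x
      have n1: "norm (h k *\<^sub>R e) \<le> 1" using h[of k] e by simp
      consider (a) "x \<in> cball 0 (B+1)" "x + h k *\<^sub>R e \<in> cball 0 (B + 1)"
        | (b) "u x = 0" "u (x + h k *\<^sub>R e) = 0"
      proof -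
        have "norm (x + h k *\<^sub>R e) \<le> norm x + 1" "norm x \<le> norm (x + h k *\<^sub>R e) + 1"
          using n1 norm_triangle_ineq[of x "h k *\<^sub>R e"]
            norm_triangle_ineq4[of "x + h k *\<^sub>R e" "h k *\<^sub>R e"] by simp_all
        then show ?thesis
          using that supp[of x] supp[of "x + h k *\<^sub>R e"] unfolding mem_cball_0 by linarith
      qed
      then show "norm (s k x) \<le> K * indicator (cball 0 (B + 1)) x"
      proof cases
        case a
        have "\<bar>u (x + h k *\<^sub>R e) - u x\<bar> \<le> K * h k"
          using lip[OF a(2,1)] h[of k] e by simp
        then show ?thesis using h[of k] a by (simp add: s_def divide_le_eq)
      next
        case b
        show ?thesis using b K by (simp add: s_def indicator_def)
      qed
    qed
    show "AE x in lborel. (\<lambda>k. s k x) \<longlonglongrightarrow> d x"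
      using der
    proof eventually_elim
      case (elim x)
      have quot: "((\<lambda>z. (u (x + z *\<^sub>R e) - u x) / z) \<longlongrightarrow> d x) (at 0)"
        using elim unfolding DERIV_def by simp
      have "filterlim h (at 0) sequentially"
        using h0 h(1) by (simp add: filterlim_at less_imp_neq[symmetric])
      from filterlim_compose[OF quot this] show ?case by (simp add: s_def)
    qed
  qed
  then show ?thesis unfolding int0 by (simp add: LIMSEQ_const_iff)
qed

text \<open>
  The gradient \<open>g\<close> exists only almost everywhere, on account of kinks; it is carried along as data
  because each use prescribes it by an explicit formula.
\<close>

definition lipschitz_cutoff :: "real \<Rightarrow> ('a::euclidean_space \<Rightarrow> real) \<Rightarrow> ('a \<Rightarrow> 'a) \<Rightarrow> bool" where
  "lipschitz_cutoff B \<zeta> g \<longleftrightarrow>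
     B > 0 \<and> (\<exists>K. K-lipschitz_on UNIV \<zeta>) \<and> g \<in> borel_measurable borel \<and> bounded (range g) \<and>
     (\<forall>x. norm x \<ge> B \<longrightarrow> \<zeta> x = 0 \<and> g x = 0) \<and>
     (AE x in lborel. (\<zeta> has_derivative (\<lambda>h. g x \<bullet> h)) (at x))"

lemma lipschitz_cutoffD:
  assumes "lipschitz_cutoff B \<zeta> g"
  shows "B > 0" "continuous_on UNIV \<zeta>" "\<zeta> \<in> borel_measurable borel" "g \<in> borel_measurable borel"
    and "\<And>x. norm x \<ge> B \<Longrightarrow> \<zeta> x = 0" "\<And>x. norm x \<ge> B \<Longrightarrow> g x = 0"
    and "\<exists>C. \<forall>x. \<bar>\<zeta> x\<bar> \<le> C \<and> norm (g x) \<le> C"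
proof -
  show "B > 0" "g \<in> borel_measurable borel"
    and z: "\<And>x. norm x \<ge> B \<Longrightarrow> \<zeta> x = 0" "\<And>x. norm x \<ge> B \<Longrightarrow> g x = 0"
    using assms by (auto simp: lipschitz_cutoff_def)
  obtain K where "K-lipschitz_on UNIV \<zeta>" using assms by (auto simp: lipschitz_cutoff_def)
  then show c: "continuous_on UNIV \<zeta>" by (rule lipschitz_on_continuous_on)
  then show "\<zeta> \<in> borel_measurable borel" by (rule borel_measurable_continuous_onI)
  have "bounded (\<zeta> ` cball 0 B)"
    by (intro compact_imp_bounded compact_continuous_image continuous_on_subset[OF c]) auto
  then obtain C1 where C1: "\<And>x. norm x \<le> B \<Longrightarrow> \<bar>\<zeta> x\<bar> \<le> C1"
    unfolding bounded_iff by force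
  obtain C2 where C2: "\<And>x. norm (g x) \<le> C2" using assms by (auto simp: lipschitz_cutoff_def bounded_iff)
  have "\<bar>\<zeta> x\<bar> \<le> max C1 C2 \<and> norm (g x) \<le> max C1 C2" for x
    using C1[of x] C2[of x] order_trans[OF norm_ge_zero C2] z(1)[of x]
    by (cases "norm x \<le> B") (auto simp: le_max_iff_disj)
  then show "\<exists>C. \<forall>x. \<bar>\<zeta> x\<bar> \<le> C \<and> norm (g x) \<le> C" by blast
qed

lemma lipschitz_cutoff_integrable:
  assumes "lipschitz_cutoff B \<zeta> g" 
  shows "continuous_on UNIV f \<Longrightarrow> integrable lborel (\<lambda>x. \<zeta> x * f x)"
    and "continuous_on UNIV F \<Longrightarrow> integrable lborel (\<lambda>x. g x \<bullet> F x)"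
proof -
  note D = lipschitz_cutoffD[OF assms]
  obtain C where C: "\<And>x. \<bar>\<zeta> x\<bar> \<le> C" "\<And>x. norm (g x) \<le> C" using D(7) by auto
  show "integrable lborel (\<lambda>x. \<zeta> x * f x)" if "continuous_on UNIV f"
    by (rule integrable_cutoff_mult[where C = C and B = B]) (use D C that in auto)
  show "integrable lborel (\<lambda>x. g x \<bullet> F x)" if F: "continuous_on UNIV F"
  proof -
    have "integrable lborel (\<lambda>x. (g x \<bullet> i) * (F x \<bullet> i))" if "i \<in> Basis" for i
    proof (rule integrable_cutoff_mult[where C = C and B = B])
      show "(\<lambda>x. g x \<bullet> i) \<in> borel_measurable borel" using D(4) by measurable
      show "\<bar>g x \<bullet> i\<bar> \<le> C" for x using C(2)[of x] Basis_le_norm[OF that, of "g x"] by linarith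
      show "continuous_on UNIV (\<lambda>x. F x \<bullet> i)" using F by (intro continuous_intros)
    qed (use D in auto)
    then show ?thesis by (subst euclidean_inner) (intro Bochner_Integration.integrable_sum)
  qed
qed

lemma divergence_eq:
  assumes "(F has_derivative F') (at x)"
  shows "divergence F x = (\<Sum>i\<in>UNIV. F' (axis i 1) $ i)"
  using frechet_derivative_at[OF assms] by (simp add: divergence_def)

lemma C1_divergence_continuous:
  assumes "C1_on UNIV F"
  shows "continuous_on UNIV (divergence F)"
proof -
  obtain f' where f': "\<And>x. (F has_derivative blinfun_apply (f' x)) (at x)" "continuous_on UNIV f'"
    using assms by (auto simp: C1_on_def)
  have "divergence F = (\<lambda>x. \<Sum>i\<in>UNIV. f' x (axis i 1) $ i)"
    using divergence_eq[OF f'(1)] by auto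
  then show ?thesis using f'(2) by (auto intro!: continuous_intros)
qed

text \<open>
  The divergence theorem in weak form: each field component times \<open>\<zeta>\<close> is a compactly supported
  Lipschitz function, whose directional derivative along the corresponding axis integrates to zero.
\<close>

lemma lipschitz_cutoff_divergence:
  fixes F :: "real^'n \<Rightarrow> real^'n"
  assumes \<zeta>: "lipschitz_cutoff B \<zeta> g" and F: "C1_on UNIV F"
  shows "(\<integral>x. \<zeta> x * divergence F x \<partial>lborel) = - (\<integral>x. g x \<bullet> F x \<partial>lborel)"
proof -
  note D = lipschitz_cutoffD[OF \<zeta>]
  obtain K where K: "K-lipschitz_on UNIV \<zeta>" using \<zeta> by (auto simp: lipschitz_cutoff_def)
  obtain C where C: "\<And>x. \<bar>\<zeta> x\<bar> \<le> C" "\<And>x. norm (g x) \<le> C" using D(7) by auto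
  obtain f' where f': "\<And>x. (F has_derivative blinfun_apply (f' x)) (at x)" "continuous_on UNIV f'"
    using F by (auto simp: C1_on_def)
  have cF: "continuous_on UNIV F"
    using f'(1) by (auto intro!: continuous_at_imp_continuous_on has_derivative_continuous)
  define S where "S = cball (0 :: real^'n) (B + 1)"
  have "bounded (f' ` S)" "bounded (F ` S)"
    unfolding S_def
    by (intro compact_imp_bounded compact_continuous_image continuous_on_subset[OF f'(2)]
        continuous_on_subset[OF cF]; auto)+
  then obtain L M where L: "\<And>x. x \<in> S \<Longrightarrow> norm (f' x) \<le> L" and M: "\<And>x. x \<in> S \<Longrightarrow> norm (F x) \<le> M"
    by (auto simp: bounded_iff)
  have "0 \<in> S" using D(1) by (simp add: S_def)
  then have pos: "0 \<le> L" "0 \<le> M" "0 \<le> C" "0 \<le> K"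
    using L M C(1)[of 0] lipschitz_on_nonneg[OF K] by (meson norm_ge_zero order_trans abs_ge_zero)+
  have lipF: "norm (F x - F y) \<le> L * norm (x - y)" if "x \<in> S" "y \<in> S" for x y
  proof (rule differentiable_bound[of S F "\<lambda>x. blinfun_apply (f' x)"])
    show "convex S" by (simp add: S_def)
    show "(F has_derivative blinfun_apply (f' x)) (at x within S)" for x
      using f'(1) has_derivative_at_withinI by blast
    show "onorm (blinfun_apply (f' x)) \<le> L" if "x \<in> S" for x
      using L[OF that] by (simp add: norm_blinfun.rep_eq)
  qed (use that in auto)
  define d where "d i x = \<zeta> x * f' x (axis i 1) $ i + g x $ i * F x $ i" for i x
  have id: "integrable lborel (d i)" for i
  proof -
    have "integrable lborel (\<lambda>x. \<zeta> x * f' x (axis i 1) $ i)"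
      using f'(2) by (intro lipschitz_cutoff_integrable(1)[OF \<zeta>] continuous_intros)
    moreover have "integrable lborel (\<lambda>x. g x $ i * F x $ i)"
    proof -
      have "continuous_on UNIV (\<lambda>x. F x $ i *\<^sub>R axis i (1::real))" using cF by (intro continuous_intros)
      from lipschitz_cutoff_integrable(2)[OF \<zeta> this] show ?thesis
        by (simp add: inner_axis mult.commute)
    qed
    ultimately show ?thesis unfolding d_def by simp
  qed
  \<comment> \<open>the product rule gives the derivative \<open>d i\<close> of \<open>\<zeta> F\<^sub>i\<close> along the \<open>i\<close>-th axis\<close>
  have d0: "(\<integral>x. d i x \<partial>lborel) = 0" for i
  proof (rule integral_directional_derivative_eq_0[where B = B and K = "C * L + K * M"
        and u = "\<lambda>x. \<zeta> x * F x $ i" and e = "axis i 1"])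
    show "\<bar>\<zeta> x * F x $ i - \<zeta> y * F y $ i\<bar> \<le> (C * L + K * M) * norm (x - y)"
      if "x \<in> cball 0 (B + 1)" "y \<in> cball 0 (B + 1)" for x y
    proof -
      have "\<bar>F x $ i - F y $ i\<bar> \<le> L * norm (x - y)"
        using lipF[of x y] that component_le_norm_cart[of "F x - F y" i] by (simp add: S_def)
      then have "\<bar>\<zeta> x * (F x $ i - F y $ i)\<bar> \<le> C * (L * norm (x - y))"
        unfolding abs_mult using C(1)[of x] pos by (intro mult_mono) auto
      moreover have "\<bar>\<zeta> x - \<zeta> y\<bar> \<le> K * norm (x - y)"
        using lipschitz_onD[OF K, of x y] by (simp add: dist_norm)
      then have "\<bar>(\<zeta> x - \<zeta> y) * F y $ i\<bar> \<le> K * norm (x - y) * M"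
        unfolding abs_mult using M[of y] that component_le_norm_cart[of "F y" i] pos
        by (intro mult_mono) (auto simp: S_def)
      moreover have "\<zeta> x * F x $ i - \<zeta> y * F y $ i = \<zeta> x * (F x $ i - F y $ i) + (\<zeta> x - \<zeta> y) * F y $ i"
        by (simp add: algebra_simps)
      ultimately show ?thesis by (simp add: algebra_simps)
    qed
    show "AE x in lborel. ((\<lambda>h. \<zeta> (x + h *\<^sub>R axis i 1) * F (x + h *\<^sub>R axis i 1) $ i) has_real_derivative d i x) (at 0)"
    proof -
      have "AE x in lborel. (\<zeta> has_derivative (\<lambda>h. g x \<bullet> h)) (at x)"
        using \<zeta> by (simp add: lipschitz_cutoff_def)
      then show ?thesis
      proof eventually_elim
        case (elim x)
        have line: "((\<lambda>h. x + h *\<^sub>R axis i 1) has_derivative (\<lambda>h. h *\<^sub>R axis i 1)) (at 0)"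
          by (auto intro!: derivative_eq_intros)
        have "((\<lambda>y. \<zeta> y * F y $ i) has_derivative (\<lambda>h. \<zeta> x * f' x h $ i + (g x \<bullet> h) * F x $ i)) (at x)"
          using has_derivative_mult[OF elim bounded_linear.has_derivative[OF bounded_linear_vec_nth f'(1)]] .
        then have "((\<lambda>y. \<zeta> y * F y $ i) has_derivative (\<lambda>h. \<zeta> x * f' x h $ i + (g x \<bullet> h) * F x $ i))
            (at (x + 0 *\<^sub>R axis i 1))" by simp
        from has_derivative_compose[OF line this]
        have "((\<lambda>h. \<zeta> (x + h *\<^sub>R axis i 1) * F (x + h *\<^sub>R axis i 1) $ i) has_derivative
            (\<lambda>h. \<zeta> x * f' x (h *\<^sub>R axis i 1) $ i + (g x \<bullet> (h *\<^sub>R axis i 1)) * F x $ i)) (at 0)" .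
        moreover have "(\<lambda>h. \<zeta> x * f' x (h *\<^sub>R axis i 1) $ i
            + (g x \<bullet> (h *\<^sub>R axis i 1)) * F x $ i) = (*) (d i x)"
          by (auto simp: d_def inner_axis blinfun.scaleR_right algebra_simps)
        ultimately show ?case
          unfolding has_field_derivative_def by (simp only:)
      qed
    qed
    show "d i \<in> borel_measurable borel" using id[of i] by simp
    show "continuous_on UNIV (\<lambda>x. \<zeta> x * F x $ i)" using D(2) cF by (intro continuous_intros)
  qed (use D pos in auto)
  have "(\<integral>x. \<zeta> x * divergence F x \<partial>lborel) + (\<integral>x. g x \<bullet> F x \<partial>lborel)
      = (\<integral>x. \<zeta> x * divergence F x + g x \<bullet> F x \<partial>lborel)"
    using \<zeta> cF C1_divergence_continuous[OF F]
    by (simp add: lipschitz_cutoff_integrable)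
  also have "\<dots> = (\<integral>x. (\<Sum>i\<in>UNIV. d i x) \<partial>lborel)"
    by (intro Bochner_Integration.integral_cong refl)
      (simp add: d_def divergence_eq[OF f'(1)] sum.distrib sum_distrib_left inner_vec_def)
  also have "\<dots> = 0" using id d0 by (simp add: Bochner_Integration.integral_sum)
  finally show ?thesis by simp
qed

section \<open>Radial cutoffs and their potentials\<close>

text \<open>
  The profile is linear in \<open>r ^ n\<close> between the radii \<open>a\<close> and \<open>b\<close>. With \<open>n\<close> the space dimension,
  the gradient of the radial cutoff has size \<open>n r ^ (n - 1) / (b ^ n - a ^ n)\<close> on the annulus, so
  its product with \<open>r ^ (1 - n)\<close> is constant there and the annulus contributes exactly the area
  of the unit sphere. This plays the part of an integral over spheres averaged over their radius.
\<close>

definition cutoff_profile :: "nat \<Rightarrow> real \<Rightarrow> real \<Rightarrow> real \<Rightarrow> real" where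
  "cutoff_profile n a b r = (b ^ n - (max a (min b r)) ^ n) / (b ^ n - a ^ n)"

lemma cutoff_profile_props:
  assumes ab: "0 < a" "a < b" and n: "n > 0"
  shows "b ^ n - a ^ n > 0"
    and "0 \<le> cutoff_profile n a b r" "cutoff_profile n a b r \<le> 1"
    and "r \<le> a \<Longrightarrow> cutoff_profile n a b r = 1"
    and "b \<le> r \<Longrightarrow> cutoff_profile n a b r = 0"
    and "a \<le> r \<Longrightarrow> r \<le> b \<Longrightarrow> cutoff_profile n a b r = (b ^ n - r ^ n) / (b ^ n - a ^ n)"
proof -
  show pos: "b ^ n - a ^ n > 0" using ab n by (simp add: power_strict_mono)
  have "max a (min b r) ^ n \<le> b ^ n" "a ^ n \<le> max a (min b r) ^ n"
    using ab by (intro power_mono; simp)+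
  then show "0 \<le> cutoff_profile n a b r" "cutoff_profile n a b r \<le> 1"
    using pos by (auto simp: cutoff_profile_def divide_simps)
  show "r \<le> a \<Longrightarrow> cutoff_profile n a b r = 1" using ab pos by (simp add: cutoff_profile_def max_def min_def)
  show "b \<le> r \<Longrightarrow> cutoff_profile n a b r = 0" using ab pos by (simp add: cutoff_profile_def max_def min_def)
  show "a \<le> r \<Longrightarrow> r \<le> b \<Longrightarrow> cutoff_profile n a b r = (b ^ n - r ^ n) / (b ^ n - a ^ n)"
    using ab pos by (auto simp: cutoff_profile_def max_def min_def)
qed

lemma cutoff_profile_lipschitz:
  assumes ab: "0 < a" "a < b" and n: "n > 0"
  shows "(real n * b ^ (n - 1) / (b ^ n - a ^ n))-lipschitz_on UNIV (cutoff_profile n a b)"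
proof (rule lipschitz_onI)
  note pos = cutoff_profile_props(1)[OF assms]
  show "0 \<le> real n * b ^ (n - 1) / (b ^ n - a ^ n)" using pos ab by simp
  fix r s :: real
  define c where "c r = max a (min b r)" for r
  have c: "c r \<in> {a..b}" for r using ab by (auto simp: c_def)
  \<comment> \<open>the truncated radii lie in \<open>[a, b]\<close>, where the slope of the power is largest at \<open>b\<close>\<close>
  have "norm (c r ^ n - c s ^ n) \<le> real n * b ^ (n - 1) * norm (c r - c s)"
  proof (rule field_differentiable_bound[of "{a..b}" "\<lambda>r. r ^ n" "\<lambda>r. real n * r ^ (n - 1)"])
    show "norm (real n * z ^ (n - 1)) \<le> real n * b ^ (n - 1)" if "z \<in> {a..b}" for z
      using that ab by (auto simp: abs_mult power_abs intro!: mult_left_mono power_mono)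
  qed (use c in \<open>auto intro!: derivative_eq_intros\<close>)
  moreover have "\<bar>c r - c s\<bar> \<le> \<bar>r - s\<bar>" by (auto simp: c_def max_def min_def)
  then have "real n * b ^ (n - 1) * \<bar>c r - c s\<bar> \<le> real n * b ^ (n - 1) * \<bar>r - s\<bar>"
    using ab by (intro mult_left_mono) auto
  ultimately have "\<bar>c r ^ n - c s ^ n\<bar> \<le> real n * b ^ (n - 1) * \<bar>r - s\<bar>"
    by simp
  moreover have "cutoff_profile n a b r - cutoff_profile n a b s = - (c r ^ n - c s ^ n) / (b ^ n - a ^ n)"
    by (simp add: cutoff_profile_def c_def diff_divide_distrib)
  ultimately show "dist (cutoff_profile n a b r) (cutoff_profile n a b s)
      \<le> real n * b ^ (n - 1) / (b ^ n - a ^ n) * dist r s"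
    using pos by (simp add: dist_real_def divide_simps)
qed

definition radial_cutoff :: "real \<Rightarrow> real \<Rightarrow> 'a::euclidean_space \<Rightarrow> real" where
  "radial_cutoff a b x = cutoff_profile DIM('a) a b (norm x)"

definition radial_cutoff_gradient :: "real \<Rightarrow> real \<Rightarrow> 'a::euclidean_space \<Rightarrow> 'a" where
  "radial_cutoff_gradient a b x =
     (indicator {x. a < norm x \<and> norm x < b} x *
       - (real DIM('a) * norm x ^ (DIM('a) - 1) / (b ^ DIM('a) - a ^ DIM('a)))) *\<^sub>R sgn x"

lemma lipschitz_cutoff_radial:
  assumes ab: "0 < a" "a < b"
  shows "lipschitz_cutoff b (radial_cutoff a b :: 'a::euclidean_space \<Rightarrow> real) (radial_cutoff_gradient a b)"
  unfolding lipschitz_cutoff_def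
proof (intro conjI allI impI)
  let ?n = "DIM('a)"
  define \<phi> where "\<phi> = (radial_cutoff a b :: 'a \<Rightarrow> real)"
  note P = cutoff_profile_props[OF ab DIM_positive[where 'a = 'a]]
  note pos = P(1)
  show "0 < b" using ab by simp
  have "1-lipschitz_on UNIV (norm :: 'a \<Rightarrow> real)"
    by (rule lipschitz_onI) (auto simp: dist_norm norm_triangle_ineq3)
  from lipschitz_on_compose2[OF this lipschitz_on_subset[OF cutoff_profile_lipschitz[OF ab DIM_positive[where 'a = 'a]]]]
  show "\<exists>K. K-lipschitz_on UNIV (radial_cutoff a b :: 'a \<Rightarrow> real)"
    unfolding radial_cutoff_def by blast
  show "radial_cutoff a b x = 0" if "b \<le> norm x" for x :: 'a
    using P(5)[OF that] by (simp add: radial_cutoff_def)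
  show "radial_cutoff_gradient a b x = 0" if "b \<le> norm x" for x :: 'a
    using that by (simp add: radial_cutoff_gradient_def indicator_def)
  show "radial_cutoff_gradient a b \<in> borel_measurable (borel :: 'a measure)"
    unfolding radial_cutoff_gradient_def[abs_def] sgn_div_norm by measurable
  have "norm (radial_cutoff_gradient a b x) \<le> real ?n * b ^ (?n - 1) / (b ^ ?n - a ^ ?n)" for x :: 'a
  proof (cases "a < norm x \<and> norm x < b")
    case True
    then show ?thesis
      using pos ab by (auto simp: radial_cutoff_gradient_def norm_sgn intro!: divide_right_mono mult_left_mono power_mono)
  next
    case False
    then have "radial_cutoff_gradient a b x = 0"
      by (auto simp: radial_cutoff_gradient_def indicator_def)
    then show ?thesis using pos ab by simp
  qed
  then show "bounded (range (radial_cutoff_gradient a b :: 'a \<Rightarrow> 'a))" by (auto simp: bounded_iff)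
  have "AE x::'a in lborel. x \<notin> sphere 0 a \<union> sphere 0 b"
  proof (rule AE_not_in)
    show "sphere 0 a \<union> sphere 0 b \<in> null_sets (lborel :: 'a measure)"
      using negligible_sphere[of "0::'a"]
      by (intro null_sets.Un) (auto simp: negligible_iff_null_sets null_sets_completion_iff)
  qed
  then show "AE x::'a in lborel. (radial_cutoff a b has_derivative (\<bullet>) (radial_cutoff_gradient a b x)) (at x)"
  proof eventually_elim
    case (elim x)
    then consider "norm x < a" | "a < norm x" "norm x < b" | "b < norm x" by fastforce
    then show ?case
    proof cases
      case 1
      have "(\<bullet>) (radial_cutoff_gradient a b x) = (\<lambda>h. 0)"
        using 1 by (auto simp: radial_cutoff_gradient_def)
      then have "((\<lambda>x. 1) has_derivative (\<bullet>) (radial_cutoff_gradient a b x)) (at x)"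
        by simp
      then show ?thesis
        by (rule has_derivative_transform_within_open[of _ _ _ _ "ball 0 a"])
           (use 1 P(4) in \<open>auto simp: radial_cutoff_def\<close>)
    next
      case 3
      have "(\<bullet>) (radial_cutoff_gradient a b x) = (\<lambda>h. 0)"
        using 3 by (auto simp: radial_cutoff_gradient_def)
      then have "((\<lambda>x. 0) has_derivative (\<bullet>) (radial_cutoff_gradient a b x)) (at x)"
        by simp
      then show ?thesis
        by (rule has_derivative_transform_within_open[of _ _ _ _ "- cball 0 b"])
           (use 3 P(5) in \<open>auto simp: radial_cutoff_def\<close>)
    next
      case 2
      then have "x \<noteq> 0" using ab by auto
      then have "((\<lambda>x. (b ^ ?n - norm x ^ ?n) / (b ^ ?n - a ^ ?n)) has_derivative
          (\<lambda>h. (0 - real ?n * (h \<bullet> sgn x) * norm x ^ (?n - 1)) / (b ^ ?n - a ^ ?n))) (at x)"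
        by (intro bounded_linear.has_derivative[OF bounded_linear_divide] has_derivative_diff has_derivative_const
            has_derivative_power has_derivative_norm) (use pos in auto)
      moreover have "(\<lambda>h. (0 - real ?n * (h \<bullet> sgn x) * norm x ^ (?n - 1)) / (b ^ ?n - a ^ ?n))
          = (\<bullet>) (radial_cutoff_gradient a b x)"
        using 2 by (auto simp: radial_cutoff_gradient_def inner_commute)
      ultimately have "((\<lambda>x. (b ^ ?n - norm x ^ ?n) / (b ^ ?n - a ^ ?n)) has_derivative
          (\<bullet>) (radial_cutoff_gradient a b x)) (at x)"
        by simp
      then show ?thesis
        by (rule has_derivative_transform_within_open[of _ _ _ _ "ball 0 b - cball 0 a"])
           (use 2 P(6) in \<open>auto simp: radial_cutoff_def open_Diff\<close>)
    qed
  qed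
qed

lemma integral_radial_annulus:
  assumes ab: "0 < a" "a < b"
  shows "integrable lborel (\<lambda>x::'a::euclidean_space. C * indicator {x. a < norm x \<and> norm x < b} x :: real)"
    and "(\<integral>x. C * indicator {x::'a. a < norm x \<and> norm x < b} x \<partial>lborel)
         = C * (measure lborel (ball (0::'a) 1) * (b ^ DIM('a) - a ^ DIM('a)))"
proof -
  have A: "{x::'a. a < norm x \<and> norm x < b} = ball 0 b - cball 0 a" by auto
  have fin: "emeasure lborel (ball (0::'a) b) \<noteq> \<infinity>" "emeasure lborel (cball (0::'a) a) \<noteq> \<infinity>"
    using emeasure_bounded_finite[of "ball (0::'a) b"] emeasure_bounded_finite[of "cball (0::'a) a"]
    by (simp_all add: top.not_eq_extremum)
  have "measure lborel (ball 0 b - cball (0::'a) a) = measure lborel (ball (0::'a) b) - measure lborel (cball (0::'a) a)"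
    using ab fin by (intro Measure_Space.measure_Diff) auto
  also have "\<dots> = measure lborel (ball (0::'a) 1) * (b ^ DIM('a) - a ^ DIM('a))"
    using ab by (simp add: content_ball content_cball algebra_simps)
  finally have m: "measure lborel (ball 0 b - cball (0::'a) a) = measure lborel (ball (0::'a) 1) * (b ^ DIM('a) - a ^ DIM('a))" .
  have "emeasure lborel (ball 0 b - cball (0::'a) a) < \<infinity>"
    by (intro emeasure_bounded_finite) (auto intro: bounded_diff)
  then show "integrable lborel (\<lambda>x::'a. C * indicator {x. a < norm x \<and> norm x < b} x :: real)"
    unfolding A by (intro integrable_mult_right integrable_real_indicator) auto
  show "(\<integral>x. C * indicator {x::'a. a < norm x \<and> norm x < b} x \<partial>lborel)
         = C * (measure lborel (ball (0::'a) 1) * (b ^ DIM('a) - a ^ DIM('a)))"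
    unfolding A by (simp add: m)
qed

text \<open>
  The compactly supported function with gradient \<open>- radial_cutoff a b x *\<^sub>R x\<close>; it replaces
  \<open>(R\<^sup>2 - norm x ^ 2) / 2\<close> on a ball of radius \<open>R\<close>. Integrating in the variable \<open>norm x ^ 2\<close>
  keeps it differentiable at the origin.
\<close>

definition radial_potential :: "real \<Rightarrow> real \<Rightarrow> 'a::euclidean_space \<Rightarrow> real" where
  "radial_potential a b x =
     integral {(norm x)\<^sup>2..b\<^sup>2} (\<lambda>s. cutoff_profile DIM('a) a b (sqrt s) / 2)"

lemma radial_potential_nonneg:
  assumes "0 < a" "a < b"
  shows "0 \<le> radial_potential a b (x::'a::euclidean_space)"
proof -
  have "continuous_on UNIV (cutoff_profile DIM('a) a b)"
    using cutoff_profile_lipschitz[OF assms DIM_positive[where 'a = 'a]] by (rule lipschitz_on_continuous_on)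
  then have "continuous_on {(norm x)\<^sup>2..b\<^sup>2} (\<lambda>s. cutoff_profile DIM('a) a b (sqrt s) / 2)"
    by (intro continuous_on_divide continuous_on_const
        continuous_on_compose2[of UNIV "cutoff_profile DIM('a) a b" _ sqrt] continuous_on_real_sqrt
        continuous_on_id) auto
  then show ?thesis unfolding radial_potential_def
    using cutoff_profile_props(2)[OF assms DIM_positive[where 'a = 'a]]
    by (intro Henstock_Kurzweil_Integration.integral_nonneg integrable_continuous_real) auto
qed

lemma lipschitz_cutoff_potential:
  assumes ab: "0 < a" "a < b"
  shows "lipschitz_cutoff b (radial_potential a b :: 'a::euclidean_space \<Rightarrow> real)
           (\<lambda>x. - (radial_cutoff a b x) *\<^sub>R x)"
proof -
  let ?n = "DIM('a)"
  note P = cutoff_profile_props[OF ab DIM_positive[where 'a = 'a]]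
  define m where "m s = cutoff_profile ?n a b (sqrt s) / 2" for s
  have "continuous_on UNIV (cutoff_profile ?n a b)"
    using cutoff_profile_lipschitz[OF ab DIM_positive[where 'a = 'a]] by (rule lipschitz_on_continuous_on)
  then have m: "continuous_on S m" for S
    unfolding m_def
    by (intro continuous_on_divide continuous_on_const
        continuous_on_compose2[of UNIV "cutoff_profile ?n a b" _ sqrt] continuous_on_real_sqrt
        continuous_on_id) auto
  have m0: "m s = 0" if "b\<^sup>2 \<le> s" for s
    using P(5)[of "sqrt s"] that ab real_le_rsqrt[of b s] by (simp add: m_def)
  define G where "G s = integral {s..b\<^sup>2} m" for s
  have G0: "G s = 0" if "b\<^sup>2 \<le> s" for s
    using that by (cases "s = b\<^sup>2") (auto simp: G_def)
  have GC: "G s = integral {s..C} m" if "b\<^sup>2 \<le> C" "s \<le> C" for s C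
  proof (cases "s \<le> b\<^sup>2")
    case True
    have "integral {s..b\<^sup>2} m + integral {b\<^sup>2..C} m = integral {s..C} m"
      using True that m by (intro Henstock_Kurzweil_Integration.integral_combine integrable_continuous_real) auto
    moreover have "integral {b\<^sup>2..C} m = 0"
      using m0 by (intro integral_unique has_integral_is_0) auto
    ultimately show ?thesis by (simp add: G_def)
  next
    case False
    then have "integral {s..C} m = 0" "G s = 0"
      using m0 G0 by (auto intro!: integral_unique has_integral_is_0)
    then show ?thesis by simp
  qed
  have dG: "(G has_real_derivative - m s) (at s)" for s
  proof -
    define C where "C = max (b\<^sup>2) (s + 1)"
    have "((\<lambda>u. integral {u..C} m) has_vector_derivative - m s) (at s within {s - 1..C})"
      by (rule integral_has_vector_derivative'[OF m]) (auto simp: C_def)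
    moreover have "at s within {s - 1..C} = at s"
      by (rule at_within_interior) (auto simp: C_def)
    ultimately have "((\<lambda>u. integral {u..C} m) has_real_derivative - m s) (at s)"
      by (simp add: has_real_derivative_iff_has_vector_derivative)
    then show ?thesis
      by (rule has_field_derivative_transform_within_open[of _ _ _ "{..<C}"])
        (auto simp: C_def intro!: GC[symmetric])
  qed
  have Psi: "radial_potential a b x = G (x \<bullet> x)" for x :: 'a
    by (simp add: radial_potential_def G_def m_def[abs_def] power2_norm_eq_inner)
  have D: "(radial_potential a b has_derivative (\<lambda>h. (- radial_cutoff a b x *\<^sub>R x) \<bullet> h)) (at x)" for x :: 'a
  proof -
    have "((\<lambda>x. x \<bullet> x) has_derivative (\<lambda>h. x \<bullet> h + h \<bullet> x)) (at x)"
      by (auto intro!: derivative_eq_intros)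
    from has_derivative_compose[OF this, of G "(*) (- m (x \<bullet> x))"] dG[of "x \<bullet> x"]
    have "((\<lambda>x. G (x \<bullet> x)) has_derivative (\<lambda>h. - m (x \<bullet> x) * (x \<bullet> h + h \<bullet> x))) (at x)"
      by (simp add: has_field_derivative_def)
    moreover have "(\<lambda>h. - m (x \<bullet> x) * (x \<bullet> h + h \<bullet> x)) = (\<lambda>h. (- radial_cutoff a b x *\<^sub>R x) \<bullet> h)"
      by (auto simp: m_def radial_cutoff_def norm_eq_sqrt_inner inner_commute)
    ultimately show ?thesis by (simp add: Psi[abs_def])
  qed
  have bd: "norm (- radial_cutoff a b x *\<^sub>R x) \<le> b" for x :: 'a
  proof (cases "norm x < b")
    case True
    then have "radial_cutoff a b x * norm x \<le> 1 * b"
      using P(2,3) by (intro mult_mono) (auto simp: radial_cutoff_def)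
    then show ?thesis using P(2) by (simp add: radial_cutoff_def)
  next
    case False
    then show ?thesis using P(5) ab by (simp add: radial_cutoff_def)
  qed
  have phi: "radial_cutoff a b \<in> borel_measurable (borel :: 'a measure)"
    by (rule lipschitz_cutoffD(3)[OF lipschitz_cutoff_radial[OF ab]])
  have "b-lipschitz_on UNIV (radial_potential a b :: 'a \<Rightarrow> real)"
  proof (rule lipschitz_onI)
    fix x y :: 'a
    have "norm (radial_potential a b x - radial_potential a b y) \<le> b * norm (x - y)"
    proof (rule differentiable_bound[of UNIV _ "\<lambda>x h. (- radial_cutoff a b x *\<^sub>R x) \<bullet> h"])
      show "onorm (\<lambda>h. (- radial_cutoff a b x *\<^sub>R x) \<bullet> h) \<le> b" for x :: 'a
      proof (rule onorm_bound)
        show "norm ((- radial_cutoff a b x *\<^sub>R x) \<bullet> h) \<le> b * norm h" for h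
          using Cauchy_Schwarz_ineq2[of "- radial_cutoff a b x *\<^sub>R x" h]
            mult_right_mono[OF bd[of x] norm_ge_zero[of h]]
          unfolding real_norm_def by linarith
      qed (use ab in auto)
    qed (use D in auto)
    then show "dist (radial_potential a b x) (radial_potential a b y) \<le> b * dist x y"
      by (simp add: dist_norm)
  qed (use ab in auto)
  then show ?thesis
    unfolding lipschitz_cutoff_def
  proof (intro conjI allI impI exI)
    show "radial_potential a b x = 0" if "b \<le> norm x" for x :: 'a
      using G0[of "x \<bullet> x"] that ab by (simp add: Psi power2_norm_eq_inner[symmetric] power_mono)
    show "- radial_cutoff a b x *\<^sub>R x = 0" if "b \<le> norm x" for x :: 'a
      using P(5)[OF that] by (simp add: radial_cutoff_def)
    show "(\<lambda>x. - radial_cutoff a b x *\<^sub>R x) \<in> borel_measurable (borel :: 'a measure)"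
      using phi by measurable
    show "bounded (range (\<lambda>x::'a. - radial_cutoff a b x *\<^sub>R x))"
      using bd by (auto simp: bounded_iff)
    show "AE x::'a in lborel. (radial_potential a b has_derivative
        (\<lambda>h. (- radial_cutoff a b x *\<^sub>R x) \<bullet> h)) (at x)"
      using D by (intro AE_I2)
  qed (use ab in auto)
qed

section \<open>Continuously differentiable functions on the half-space\<close>

text \<open>
  On a finite-dimensional domain, continuity of the derivative in operator norm can be tested on
  each direction separately.
\<close>

lemma C1_onI:
  fixes f :: "'a::euclidean_space \<Rightarrow> 'b::real_normed_vector"
  assumes d: "\<And>z. z \<in> D \<Longrightarrow> (f has_derivative f' z) (at z within D)"
    and c: "\<And>h. continuous_on D (\<lambda>z. f' z h)"
  shows "C1_on D f"
  unfolding C1_on_def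
proof (intro exI conjI ballI)
  have app: "blinfun_apply (Blinfun (f' z)) = f' z" if "z \<in> D" for z
    using d[OF that] by (intro bounded_linear_Blinfun_apply has_derivative_bounded_linear)
  show "(f has_derivative blinfun_apply (Blinfun (f' z))) (at z within D)" if "z \<in> D" for z
    using d[OF that] app[OF that] by simp
  show "continuous_on D (\<lambda>z. Blinfun (f' z))"
    by (rule continuous_on_blinfun_componentwise) (simp add: app c cong: continuous_on_cong)
qed

lemma C1_onE:
  fixes f :: "'a::real_normed_vector \<Rightarrow> 'b::real_normed_vector"
  assumes "C1_on D f"
  obtains f' where "\<And>z. z \<in> D \<Longrightarrow> (f has_derivative f' z) (at z within D)"
    and "\<And>h. continuous_on D (\<lambda>z. f' z h)"
proof -
  obtain F where F: "\<And>z. z \<in> D \<Longrightarrow> (f has_derivative blinfun_apply (F z)) (at z within D)" "continuous_on D F"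
    using assms by (auto simp: C1_on_def)
  show ?thesis
    by (rule that[of "\<lambda>z. blinfun_apply (F z)"]) (use F in \<open>auto intro!: continuous_intros\<close>)
qed

lemma C1_on_continuous: "C1_on D f \<Longrightarrow> continuous_on D f"
proof (erule C1_onE)
  fix f' assume "\<And>z. z \<in> D \<Longrightarrow> (f has_derivative f' z) (at z within D)"
  then show "continuous_on D f" by (rule has_derivative_continuous_on)
qed

lemma C1_on_add:
  fixes f g :: "'a::euclidean_space \<Rightarrow> 'b::real_normed_vector"
  assumes "C1_on D f" "C1_on D g"
  shows "C1_on D (\<lambda>z. f z + g z)"
proof -
  obtain f' where f: "\<And>z. z \<in> D \<Longrightarrow> (f has_derivative f' z) (at z within D)" "\<And>h. continuous_on D (\<lambda>z. f' z h)"
    by (rule C1_onE[OF assms(1)]) (rule that; assumption)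
  obtain g' where g: "\<And>z. z \<in> D \<Longrightarrow> (g has_derivative g' z) (at z within D)" "\<And>h. continuous_on D (\<lambda>z. g' z h)"
    by (rule C1_onE[OF assms(2)]) (rule that; assumption)
  show ?thesis
    by (rule C1_onI[where f' = "\<lambda>z h. f' z h + g' z h"])
       (intro has_derivative_add continuous_on_add f g; assumption)+
qed

lemma C1_on_bounded_linear:
  fixes f :: "'a::euclidean_space \<Rightarrow> 'b::real_normed_vector"
  assumes "bounded_linear f"
  shows "C1_on D f"
  by (rule C1_onI[where f' = "\<lambda>z. f"])
    (use assms in \<open>simp_all add: bounded_linear_imp_has_derivative\<close>)

lemma C1_on_bilinear:
  fixes f :: "'a::euclidean_space \<Rightarrow> 'b::real_normed_vector"
  assumes "bounded_bilinear mul" "C1_on D f" "C1_on D g"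
  shows "C1_on D (\<lambda>z. mul (f z) (g z))"
proof -
  obtain f' where f: "\<And>z. z \<in> D \<Longrightarrow> (f has_derivative f' z) (at z within D)" "\<And>h. continuous_on D (\<lambda>z. f' z h)"
    by (rule C1_onE[OF assms(2)]) (rule that; assumption)
  obtain g' where g: "\<And>z. z \<in> D \<Longrightarrow> (g has_derivative g' z) (at z within D)" "\<And>h. continuous_on D (\<lambda>z. g' z h)"
    by (rule C1_onE[OF assms(3)]) (rule that; assumption)
  show ?thesis
  proof (rule C1_onI[where f' = "\<lambda>z h. mul (f z) (g' z h) + mul (f' z h) (g z)"])
    show "((\<lambda>z. mul (f z) (g z)) has_derivative (\<lambda>h. mul (f z) (g' z h) + mul (f' z h) (g z))) (at z within D)"
      if "z \<in> D" for z
      by (rule bounded_bilinear.FDERIV[OF assms(1) f(1)[OF that] g(1)[OF that]])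
    show "continuous_on D (\<lambda>z. mul (f z) (g' z h) + mul (f' z h) (g z))" for h
      by (intro continuous_on_add bounded_bilinear.continuous_on[OF assms(1)] f(2) g(2)
          C1_on_continuous assms)
  qed
qed

lemma at_within_half_space:
  assumes "t > (0::real)"
  shows "at (x::'a::euclidean_space, t) within UNIV \<times> {0..} = at (x, t)"
  by (rule at_within_interior) (use assms in \<open>simp add: interior_Times\<close>)

lemma C1_on_half_space_derivative:
  fixes f :: "'a::euclidean_space \<Rightarrow> real \<Rightarrow> 'b::real_normed_vector"
  assumes "C1_on (UNIV \<times> {0..}) (\<lambda>(x, t). f x t)" "t > 0"
  shows "\<exists>D. ((\<lambda>(x, t). f x t) has_derivative D) (at (x, t))"
proof -
  obtain f' where f: "\<And>z. z \<in> UNIV \<times> {0..} \<Longrightarrow> ((\<lambda>(x, t). f x t) has_derivative f' z) (at z within UNIV \<times> {0..})"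
    "\<And>h. continuous_on (UNIV \<times> {0..}) (\<lambda>z. f' z h)"
    by (rule C1_onE[OF assms(1)]) (rule that; assumption)
  have "(x, t) \<in> UNIV \<times> {0..}" using assms(2) by simp
  note f(1)[OF this, unfolded at_within_half_space[OF assms(2)]]
  then show ?thesis by (intro exI[of _ "f' (x, t)"])
qed

lemma C1_on_slice:
  fixes f :: "'a::euclidean_space \<Rightarrow> real \<Rightarrow> 'b::real_normed_vector"
  assumes C1: "C1_on (UNIV \<times> {0..}) (\<lambda>(x, t). f x t)" and t: "t \<ge> 0"
  shows "C1_on UNIV (\<lambda>x. f x t)"
proof -
  let ?D = "UNIV \<times> {0..}"
  obtain f' where f: "\<And>z. z \<in> ?D \<Longrightarrow> ((\<lambda>(x, t). f x t) has_derivative f' z) (at z within ?D)"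
    "\<And>h. continuous_on ?D (\<lambda>z. f' z h)"
    by (rule C1_onE[OF C1]) (rule that; assumption)
  show ?thesis
  proof (rule C1_onI[where f' = "\<lambda>x h. f' (x, t) (h, 0)"])
    show "((\<lambda>x. f x t) has_derivative (\<lambda>h. f' (x, t) (h, 0))) (at x within UNIV)" for x
    proof -
      have "((\<lambda>x. (x, t)) has_derivative (\<lambda>h. (h, 0))) (at x within UNIV)"
        by (auto intro!: derivative_eq_intros)
      moreover have "((\<lambda>(x, t). f x t) has_derivative f' (x, t)) (at (x, t) within (\<lambda>x. (x, t)) ` UNIV)"
        by (rule has_derivative_subset[OF f(1)]) (use t in \<open>simp_all add: image_subset_iff\<close>)
      ultimately have "((\<lambda>x. case (x, t) of (x, t) \<Rightarrow> f x t) has_derivative (\<lambda>h. f' (x, t) (h, 0))) (at x within UNIV)"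
        by (rule has_derivative_in_compose)
      then show ?thesis unfolding prod.case .
    qed
    show "continuous_on UNIV (\<lambda>x. f' (x, t) (h, 0))" for h
      by (rule continuous_on_compose2[OF f(2)]) (use t in \<open>auto intro!: continuous_intros\<close>)
  qed
qed

lemma C1_on_time_derivative:
  fixes f :: "'a::euclidean_space \<Rightarrow> real \<Rightarrow> real"
  assumes C1: "C1_on (UNIV \<times> {0..}) (\<lambda>(x, t). f x t)"
  obtains f' where "continuous_on (UNIV \<times> {0..}) (\<lambda>(x, t). f' x t)"
    and "\<And>x t. t > 0 \<Longrightarrow> (f x has_real_derivative f' x t) (at t)"
proof -
  let ?D = "UNIV \<times> {0..}"
  obtain f' where f: "\<And>z. z \<in> ?D \<Longrightarrow> ((\<lambda>(x, t). f x t) has_derivative f' z) (at z within ?D)"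
    "\<And>h. continuous_on ?D (\<lambda>z. f' z h)"
    by (rule C1_onE[OF C1]) (rule that; assumption)
  show ?thesis
  proof (rule that[of "\<lambda>x t. f' (x, t) (0, 1)"])
    show "continuous_on ?D (\<lambda>(x, t). f' (x, t) (0, 1))"
      using f(2)[of "(0, 1)"] by (simp add: split_def)
    fix x :: 'a and t :: real
    assume t: "t > 0"
    have "((\<lambda>s. (x, s)) has_derivative (\<lambda>k. (0, k))) (at t)"
      by (auto intro!: derivative_eq_intros)
    moreover have D: "((\<lambda>(x, t). f x t) has_derivative f' (x, t)) (at (x, t))"
    proof -
      have "(x, t) \<in> ?D" using t by simp
      from f(1)[OF this] show ?thesis unfolding at_within_half_space[OF t] .
    qed
    ultimately have "((\<lambda>s. case (x, s) of (x, t) \<Rightarrow> f x t) has_derivative (\<lambda>k. f' (x, t) (0, k))) (at t)"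
      by (rule has_derivative_compose)
    then have "((\<lambda>s. f x s) has_derivative (\<lambda>k. f' (x, t) (0, k))) (at t)"
      unfolding prod.case .
    moreover have "(\<lambda>k. f' (x, t) (0, k)) = (*) (f' (x, t) (0, 1))"
    proof
      show "f' (x, t) (0, k) = f' (x, t) (0, 1) * k" for k
        using linear_scale[OF has_derivative_linear[OF D], of k "(0, 1)"] by simp
    qed
    ultimately show "(f x has_real_derivative f' (x, t) (0, 1)) (at t)"
      unfolding has_field_derivative_def by (simp only:)
  qed
qed

section \<open>Conservation laws tested with cutoffs\<close>

text \<open>
  A conservation law with source, tested with a cutoff and integrated in time. The equation holds
  for positive times only; the time derivative extends continuously to \<open>t = 0\<close>, and a
  single instant does not affect the time integral.
\<close>

lemma cutoff_conservation_law:
  fixes q s :: "real^'n \<Rightarrow> real \<Rightarrow> real" and F :: "real^'n \<Rightarrow> real \<Rightarrow> real^'n"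
  assumes \<zeta>: "lipschitz_cutoff B \<zeta> g"
    and q: "C1_on (UNIV \<times> {0..}) (\<lambda>(x, t). q x t)"
    and F: "C1_on (UNIV \<times> {0..}) (\<lambda>(x, t). F x t)"
    and s: "continuous_on (UNIV \<times> {0..}) (\<lambda>(x, t). s x t)"
    and law: "\<And>x t. t > 0 \<Longrightarrow> deriv (q x) t + divergence (\<lambda>y. F y t) x = s x t"
    and t: "t \<ge> 0"
  shows "((\<lambda>\<tau>. (\<integral>x. \<zeta> x * s x \<tau> \<partial>lborel) + (\<integral>x. g x \<bullet> F x \<tau> \<partial>lborel)) has_integral
           (\<integral>x. \<zeta> x * q x t \<partial>lborel) - (\<integral>x. \<zeta> x * q x 0 \<partial>lborel)) {0..t}"
proof -
  note D = lipschitz_cutoffD[OF \<zeta>]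
  obtain C where C: "\<And>x. \<bar>\<zeta> x\<bar> \<le> C" using D(7) by auto
  obtain q' where q': "continuous_on (UNIV \<times> {0..}) (\<lambda>(x, t). q' x t)"
    "\<And>x t. t > 0 \<Longrightarrow> (q x has_real_derivative q' x t) (at t)"
    using C1_on_time_derivative[OF q] by blast
  have qc: "continuous_on (UNIV \<times> {0..}) (\<lambda>(x, t). q x t)" by (rule C1_on_continuous[OF q])
  have ftc: "integral {0..t} (q' x) = q x t - q x 0" for x
  proof (rule integral_unique, rule fundamental_theorem_of_calculus_interior[OF t])
    show "continuous_on {0..t} (q x)"
      by (rule continuous_on_subset[OF continuous_on_time_slice[OF qc]]) auto
    show "(q x has_vector_derivative q' x \<tau>) (at \<tau>)" if "\<tau> \<in> {0<..<t}" for \<tau>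
      using q'(2)[of \<tau> x] that by (simp add: has_real_derivative_iff_has_vector_derivative)
  qed
  have qi: "integrable lborel (\<lambda>x. \<zeta> x * q x \<tau>)" if "\<tau> \<ge> 0" for \<tau>
    by (rule lipschitz_cutoff_integrable(1)[OF \<zeta> continuous_on_slice[OF qc that]])
  have "((\<lambda>\<tau>. \<integral>x. \<zeta> x * q' x \<tau> \<partial>lborel) has_integral (\<integral>x. \<zeta> x * integral {0..t} (q' x) \<partial>lborel)) {0..t}"
    by (rule cutoff_integral_time_swap(2)[OF D(3) C D(5) q'(1)])
  also have "(\<integral>x. \<zeta> x * integral {0..t} (q' x) \<partial>lborel) = (\<integral>x. \<zeta> x * q x t \<partial>lborel) - (\<integral>x. \<zeta> x * q x 0 \<partial>lborel)"
    using qi t by (simp add: ftc right_diff_distrib)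
  finally have I: "((\<lambda>\<tau>. \<integral>x. \<zeta> x * q' x \<tau> \<partial>lborel) has_integral
      (\<integral>x. \<zeta> x * q x t \<partial>lborel) - (\<integral>x. \<zeta> x * q x 0 \<partial>lborel)) {0..t}" .
  have eq: "(\<integral>x. \<zeta> x * q' x \<tau> \<partial>lborel) = (\<integral>x. \<zeta> x * s x \<tau> \<partial>lborel) + (\<integral>x. g x \<bullet> F x \<tau> \<partial>lborel)"
    if "\<tau> > 0" for \<tau>
  proof -
    have FC: "C1_on UNIV (\<lambda>x. F x \<tau>)" using C1_on_slice[OF F] that by simp
    have "q' x \<tau> = s x \<tau> - divergence (\<lambda>y. F y \<tau>) x" for x
      using law[OF that, of x] DERIV_imp_deriv[OF q'(2)[OF that]] by (simp add: algebra_simps)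
    then have "(\<integral>x. \<zeta> x * q' x \<tau> \<partial>lborel)
        = (\<integral>x. \<zeta> x * s x \<tau> - \<zeta> x * divergence (\<lambda>y. F y \<tau>) x \<partial>lborel)"
      by (simp add: right_diff_distrib)
    also have "\<dots> = (\<integral>x. \<zeta> x * s x \<tau> \<partial>lborel) - (\<integral>x. \<zeta> x * divergence (\<lambda>y. F y \<tau>) x \<partial>lborel)"
      using lipschitz_cutoff_integrable(1)[OF \<zeta> continuous_on_slice[OF s, of \<tau>]]
        lipschitz_cutoff_integrable(1)[OF \<zeta> C1_divergence_continuous[OF FC]] that by simp
    finally show ?thesis by (simp add: lipschitz_cutoff_divergence[OF \<zeta> FC])
  qed
  show ?thesis
    by (rule has_integral_spike_finite[of "{0}", OF _ _ I]) (use eq in auto)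
qed

section \<open>Pointwise identities for classical solutions\<close>

lemma has_derivative_space_slice:
  assumes "((\<lambda>(y, s). f y s) has_derivative D) (at (x, t))"
  shows "((\<lambda>y. f y t) has_derivative (\<lambda>h. D (h, 0))) (at x)"
proof -
  have "((\<lambda>y. (y, t)) has_derivative (\<lambda>h. (h, 0))) (at x)"
    by (auto intro!: derivative_eq_intros)
  from has_derivative_compose[OF this assms] show ?thesis unfolding prod.case .
qed

lemma has_vector_derivative_time_slice:
  fixes f :: "'a::real_normed_vector \<Rightarrow> real \<Rightarrow> 'b::real_normed_vector"
  assumes D: "((\<lambda>(y, s). f y s) has_derivative D) (at (x, t))"
  shows "(f x has_vector_derivative D (0, 1)) (at t)"
proof -
  have "((\<lambda>s. (x, s)) has_derivative (\<lambda>k. (0, k))) (at t)"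
    by (auto intro!: derivative_eq_intros)
  from has_derivative_compose[OF this D]
  have "((\<lambda>s. f x s) has_derivative (\<lambda>k. D (0, k))) (at t)" unfolding prod.case .
  moreover have "(\<lambda>k. D (0, k)) = (\<lambda>k. k *\<^sub>R D (0, 1))"
  proof
    show "D (0, k) = k *\<^sub>R D (0, 1)" for k
      using linear_scale[OF has_derivative_linear[OF D], of k "(0, 1)"] by simp
  qed
  ultimately show ?thesis unfolding has_vector_derivative_def by (simp only:)
qed

lemma deriv_time_slice:
  fixes f :: "'a::real_normed_vector \<Rightarrow> real \<Rightarrow> real"
  assumes "((\<lambda>(y, s). f y s) has_derivative D) (at (x, t))"
  shows "deriv (f x) t = D (0, 1)"
  using has_vector_derivative_time_slice[OF assms]
  by (intro DERIV_imp_deriv) (simp add: has_real_derivative_iff_has_vector_derivative)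

lemma linear_cart_expansion:
  fixes L :: "real^'n \<Rightarrow> real"
  assumes "linear L"
  shows "(\<Sum>i\<in>UNIV. h $ i * L (axis i 1)) = L h"
proof -
  have "L h = L (\<Sum>i\<in>UNIV. h $ i *\<^sub>R axis i 1)"
    using basis_expansion[of h] by (simp add: scalar_mult_eq_scaleR)
  also have "\<dots> = (\<Sum>i\<in>UNIV. h $ i * L (axis i 1))"
    using assms by (simp add: linear_sum linear_cmul)
  finally show ?thesis ..
qed

lemma inner_gradient:
  fixes f :: "real^'n \<Rightarrow> real"
  assumes "(f has_derivative f') (at x)"
  shows "h \<bullet> gradient f x = f' h"
  using linear_cart_expansion[OF has_derivative_linear[OF assms], of h] frechet_derivative_at[OF assms]
  by (simp add: gradient_def inner_vec_def)

lemma divergence_add: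
  fixes F G :: "real^'n \<Rightarrow> real^'n"
  assumes "(F has_derivative F') (at x)" "(G has_derivative G') (at x)"
  shows "divergence (\<lambda>y. F y + G y) x = divergence F x + divergence G x"
  by (simp add: divergence_eq[OF has_derivative_add[OF assms]] divergence_eq[OF assms(1)]
      divergence_eq[OF assms(2)] sum.distrib)

lemma divergence_scaleR:
  fixes q :: "real^'n \<Rightarrow> real" and F :: "real^'n \<Rightarrow> real^'n"
  assumes q: "(q has_derivative q') (at x)" and F: "(F has_derivative F') (at x)"
  shows "divergence (\<lambda>y. q y *\<^sub>R F y) x = q x * divergence F x + q' (F x)"
  using linear_cart_expansion[OF has_derivative_linear[OF q], of "F x"]
  by (simp add: divergence_eq[OF has_derivative_scaleR[OF q F]] divergence_eq[OF F]
      sum.distrib sum_distrib_left mult.commute)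

lemma divergence_id: "divergence (\<lambda>y. y) (x::real^'n) = real CARD('n)"
  by (simp add: divergence_eq[OF has_derivative_ident])

text \<open>
  The system along particle paths: the space-time vector \<open>(V, 1)\<close> gives the material derivative.
  The momentum equation minus \<open>V\<close> times the continuity equation is
  \<open>\<rho> DV(V, 1) = - \<nabla>p\<close>, which is recorded in its pairing with arbitrary directions \<open>h\<close>. The
  pressure equation comes from differentiating the equation of state where \<open>\<rho> > 0\<close>. In vacuum
  \<open>p\<close> attains its minimum \<open>0\<close>, so its derivative vanishes and the equation holds trivially; this
  avoids differentiating \<open>\<rho> powr \<gamma>\<close> at zero density.
\<close>

lemma euler_material_form:
  fixes V :: "real^'n \<Rightarrow> real \<Rightarrow> real^'n" and \<rho> p S :: "real^'n \<Rightarrow> real \<Rightarrow> real"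
  assumes sol: "global_classical_euler_solution \<gamma> V \<rho> p S" and \<gamma>: "\<gamma> > 1" and t: "t > 0"
  obtains DV D\<rho> Dp
  where "((\<lambda>(y, s). V y s) has_derivative DV) (at (x, t))"
    and "((\<lambda>(y, s). \<rho> y s) has_derivative D\<rho>) (at (x, t))"
    and "((\<lambda>(y, s). p y s) has_derivative Dp) (at (x, t))"
    and "D\<rho> (V x t, 1) = - \<rho> x t * divergence (\<lambda>y. V y t) x"
    and "\<And>h. \<rho> x t * (h \<bullet> DV (V x t, 1)) = - Dp (h, 0)"
    and "Dp (V x t, 1) = - \<gamma> * p x t * divergence (\<lambda>y. V y t) x"
proof -
  let ?z = "(x, t)" and ?d = "divergence (\<lambda>y. V y t) x"
  have C1: "C1_on (UNIV \<times> {0..}) (\<lambda>(x, t). V x t)" "C1_on (UNIV \<times> {0..}) (\<lambda>(x, t). \<rho> x t)"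
      "C1_on (UNIV \<times> {0..}) (\<lambda>(x, t). p x t)"
    and state: "\<And>y s. s \<ge> 0 \<Longrightarrow> \<rho> y s \<ge> 0 \<and> p y s = exp (S y s) * \<rho> y s powr \<gamma>"
    and mom: "vector_derivative (\<lambda>s. \<rho> x s *\<^sub>R V x s) (at t)
          + (\<chi> i. divergence (\<lambda>y. (\<rho> y t * V y t $ i) *\<^sub>R V y t) x) + gradient (\<lambda>y. p y t) x = 0"
    and mass: "deriv (\<lambda>s. \<rho> x s) t + divergence (\<lambda>y. \<rho> y t *\<^sub>R V y t) x = 0"
    and Sd: "(\<lambda>(y, s). S y s) differentiable (at ?z)"
    and Seq: "deriv (\<lambda>s. S x s) t + V x t \<bullet> gradient (\<lambda>y. S y t) x = 0"
    using sol t unfolding global_classical_euler_solution_def by blast+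
  obtain DV where DV: "((\<lambda>(y, s). V y s) has_derivative DV) (at ?z)"
    using C1_on_half_space_derivative[OF C1(1) t] by (rule exE) (rule that)
  obtain D\<rho> where D\<rho>: "((\<lambda>(y, s). \<rho> y s) has_derivative D\<rho>) (at ?z)"
    using C1_on_half_space_derivative[OF C1(2) t] by (rule exE) (rule that)
  obtain Dp where Dp: "((\<lambda>(y, s). p y s) has_derivative Dp) (at ?z)"
    using C1_on_half_space_derivative[OF C1(3) t] by (rule exE) (rule that)
  obtain DS where DS: "((\<lambda>(y, s). S y s) has_derivative DS) (at ?z)"
    using Sd unfolding differentiable_def by (rule exE) (rule that)
  note lin = has_derivative_linear[OF DV] has_derivative_linear[OF D\<rho>]
    has_derivative_linear[OF Dp] has_derivative_linear[OF DS]
  have split: "D (V x t, 1) = D (0, 1) + D (V x t, 0)" if "linear D" for D :: "(real^'n) \<times> real \<Rightarrow> 'c::real_vector"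
    using linear_add[OF that, of "(0, 1)" "(V x t, 0)"] by simp
  have Vx: "((\<lambda>y. V y t) has_derivative (\<lambda>h. DV (h, 0))) (at x)"
    and \<rho>x: "((\<lambda>y. \<rho> y t) has_derivative (\<lambda>h. D\<rho> (h, 0))) (at x)"
    and px: "((\<lambda>y. p y t) has_derivative (\<lambda>h. Dp (h, 0))) (at x)"
    and Sx: "((\<lambda>y. S y t) has_derivative (\<lambda>h. DS (h, 0))) (at x)"
    by (rule has_derivative_space_slice; fact)+
  have mass': "D\<rho> (V x t, 1) = - \<rho> x t * ?d"
    using mass unfolding deriv_time_slice[OF D\<rho>] divergence_scaleR[OF \<rho>x Vx] split[OF lin(2)] by simp
  have comp: "\<rho> x t * DV (V x t, 1) $ i = - gradient (\<lambda>y. p y t) x $ i" for i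
  proof -
    have Vi: "((\<lambda>y. V y t $ i) has_derivative (\<lambda>h. DV (h, 0) $ i)) (at x)"
      by (rule bounded_linear.has_derivative[OF bounded_linear_vec_nth Vx])
    have "vector_derivative (\<lambda>s. \<rho> x s *\<^sub>R V x s) (at t) = \<rho> x t *\<^sub>R DV (0, 1) + D\<rho> (0, 1) *\<^sub>R V x t"
      using has_vector_derivative_scaleR[of "\<rho> x" "D\<rho> (0, 1)" t UNIV "V x" "DV (0, 1)"]
        has_vector_derivative_time_slice[OF DV] has_vector_derivative_time_slice[OF D\<rho>]
      by (intro vector_derivative_at) (simp add: has_real_derivative_iff_has_vector_derivative)
    moreover have "divergence (\<lambda>y. (\<rho> y t * V y t $ i) *\<^sub>R V y t) x
        = \<rho> x t * V x t $ i * ?d + (\<rho> x t * DV (V x t, 0) $ i + D\<rho> (V x t, 0) * V x t $ i)"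
      by (rule divergence_scaleR[OF has_derivative_mult[OF \<rho>x Vi] Vx])
    ultimately have "\<rho> x t * DV (0, 1) $ i + D\<rho> (0, 1) * V x t $ i
        + (\<rho> x t * V x t $ i * ?d + (\<rho> x t * DV (V x t, 0) $ i + D\<rho> (V x t, 0) * V x t $ i))
        + gradient (\<lambda>y. p y t) x $ i = 0"
      using arg_cong[OF mom, of "\<lambda>v. v $ i"] by simp
    moreover have "D\<rho> (0, 1) + D\<rho> (V x t, 0) = - \<rho> x t * ?d"
      using mass' split[OF lin(2)] by simp
    then have "(D\<rho> (0, 1) + D\<rho> (V x t, 0)) * V x t $ i = - \<rho> x t * ?d * V x t $ i" by simp
    ultimately show ?thesis unfolding split[OF lin(1)] by (simp add: algebra_simps)
  qed
  have "\<rho> x t *\<^sub>R DV (V x t, 1) = - gradient (\<lambda>y. p y t) x"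
    by (simp add: vec_eq_iff comp)
  then have mom': "\<rho> x t * (h \<bullet> DV (V x t, 1)) = - Dp (h, 0)" for h
    using inner_gradient[OF px, of h] by (metis inner_minus_right inner_scaleR_right)
  have press: "Dp (V x t, 1) = - \<gamma> * p x t * ?d"
  proof (cases "\<rho> x t = 0")
    case True
    then have p0: "p x t = 0" using state[of t x] t by simp
    have "Dp = (\<lambda>h. 0)"
    proof (rule has_derivative_local_min[OF Dp])
      have "eventually (\<lambda>z. snd z > 0) (at ?z)"
        using t by (intro order_tendstoD(1)[of snd t]) (auto intro!: tendsto_eq_intros)
      then show "\<forall>\<^sub>F z in at ?z. (case ?z of (y, s) \<Rightarrow> p y s) \<le> (case z of (y, s) \<Rightarrow> p y s)"
      proof eventually_elim
        case (elim z)
        then show ?case using state[of "snd z" "fst z"] p0 by (simp add: split_def)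
      qed
    qed
    then show ?thesis by (simp add: p0)
  next
    case False
    then have pos: "\<rho> x t > 0" using state[of t x] t by simp
    have ent: "DS (V x t, 1) = 0"
      using Seq unfolding deriv_time_slice[OF DS] inner_gradient[OF Sx] split[OF lin(4)] by simp
    have "((\<lambda>z. exp (case z of (y, s) \<Rightarrow> S y s) * (case z of (y, s) \<Rightarrow> \<rho> y s) powr \<gamma>) has_derivative
        (\<lambda>h. exp (S x t) * (\<rho> x t powr \<gamma> * (D\<rho> h * \<gamma> / \<rho> x t)) + exp (S x t) * DS h * \<rho> x t powr \<gamma>)) (at ?z)"
      using DS D\<rho> pos
      by (auto intro!: derivative_eq_intros simp: split_def)
    then have "((\<lambda>(y, s). p y s) has_derivative
        (\<lambda>h. exp (S x t) * (\<rho> x t powr \<gamma> * (D\<rho> h * \<gamma> / \<rho> x t)) + exp (S x t) * DS h * \<rho> x t powr \<gamma>)) (at ?z)"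
      by (rule has_derivative_transform_within_open[of _ _ _ _ "UNIV \<times> {0<..}"])
        (use t state in \<open>auto intro!: open_Times\<close>)
    from has_derivative_unique[OF Dp this]
    have "Dp (V x t, 1) = exp (S x t) * (\<rho> x t powr \<gamma> * (D\<rho> (V x t, 1) * \<gamma> / \<rho> x t))
        + exp (S x t) * DS (V x t, 1) * \<rho> x t powr \<gamma>" by simp
    also have "\<dots> = - \<gamma> * p x t * ?d"
      using pos state[of t x] t unfolding mass' ent by (simp add: field_simps)
    finally show ?thesis .
  qed
  show ?thesis by (rule that[OF DV D\<rho> Dp mass' mom' press])
qed

definition energy_density ::
    "real \<Rightarrow> (real^'n \<Rightarrow> real \<Rightarrow> real^'n) \<Rightarrow> (real^'n \<Rightarrow> real \<Rightarrow> real) \<Rightarrow>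
     (real^'n \<Rightarrow> real \<Rightarrow> real) \<Rightarrow> real^'n \<Rightarrow> real \<Rightarrow> real" where
  "energy_density \<gamma> V \<rho> p x t = 1/2 * \<rho> x t * (norm (V x t))\<^sup>2 + 1 / (\<gamma> - 1) * p x t"

definition enthalpy_density ::
    "real \<Rightarrow> (real^'n \<Rightarrow> real \<Rightarrow> real^'n) \<Rightarrow> (real^'n \<Rightarrow> real \<Rightarrow> real) \<Rightarrow>
     (real^'n \<Rightarrow> real \<Rightarrow> real) \<Rightarrow> real^'n \<Rightarrow> real \<Rightarrow> real" where
  "enthalpy_density \<gamma> V \<rho> p x t = 1/2 * \<rho> x t * (norm (V x t))\<^sup>2 + \<gamma> / (\<gamma> - 1) * p x t"

text \<open>
  In a volume moving with the fluid the work of the pressure, \<open>- V \<bullet> \<nabla>p - p div V\<close>, accounts for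
  the whole change of energy; it is absorbed by adding \<open>p\<close> to the energy density in the flux.
\<close>

lemma euler_energy_law:
  fixes V :: "real^'n \<Rightarrow> real \<Rightarrow> real^'n"
  assumes sol: "global_classical_euler_solution \<gamma> V \<rho> p S" and \<gamma>: "\<gamma> > 1" and t: "t > 0"
  shows "deriv (energy_density \<gamma> V \<rho> p x) t
    + divergence (\<lambda>y. enthalpy_density \<gamma> V \<rho> p y t *\<^sub>R V y t) x = 0"
proof -
  obtain DV D\<rho> Dp where DV: "((\<lambda>(y, s). V y s) has_derivative DV) (at (x, t))"
    and D\<rho>: "((\<lambda>(y, s). \<rho> y s) has_derivative D\<rho>) (at (x, t))"
    and Dp: "((\<lambda>(y, s). p y s) has_derivative Dp) (at (x, t))"
    and mass: "D\<rho> (V x t, 1) = - \<rho> x t * divergence (\<lambda>y. V y t) x"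
    and mom: "\<And>h. \<rho> x t * (h \<bullet> DV (V x t, 1)) = - Dp (h, 0)"
    and press: "Dp (V x t, 1) = - \<gamma> * p x t * divergence (\<lambda>y. V y t) x"
    by (rule euler_material_form[OF sol \<gamma> t, of x]) (rule that; assumption)
  \<comment> \<open>energy and enthalpy differ only in the coefficient of \<open>p\<close>, so one derivative formula serves both\<close>
  define k where "k c h = 1/2 * (\<rho> x t * (2 * (V x t \<bullet> DV h)) + D\<rho> h * (V x t \<bullet> V x t)) + c * Dp h" for c h
  have D: "((\<lambda>(y, s). 1/2 * \<rho> y s * (norm (V y s))\<^sup>2 + c * p y s) has_derivative k c) (at (x, t))" for c
  proof -
    have "((\<lambda>z. 1/2 * ((case z of (y, s) \<Rightarrow> \<rho> y s) * ((case z of (y, s) \<Rightarrow> V y s) \<bullet> (case z of (y, s) \<Rightarrow> V y s)))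
        + c * (case z of (y, s) \<Rightarrow> p y s)) has_derivative k c) (at (x, t))"
      by (rule derivative_eq_intros DV D\<rho> Dp refl)+ (auto simp: k_def fun_eq_iff inner_commute algebra_simps)
    then show ?thesis by (simp add: split_def power2_norm_eq_inner)
  qed
  have lin: "linear (k c)" for c by (rule has_derivative_linear[OF D])
  have De: "((\<lambda>(y, s). energy_density \<gamma> V \<rho> p y s) has_derivative k (1 / (\<gamma> - 1))) (at (x, t))"
    unfolding energy_density_def by (rule D)
  have Dh: "((\<lambda>(y, s). enthalpy_density \<gamma> V \<rho> p y s) has_derivative k (\<gamma> / (\<gamma> - 1))) (at (x, t))"
    unfolding enthalpy_density_def by (rule D)
  let ?d = "divergence (\<lambda>y. V y t) x"
  have eq1: "deriv (energy_density \<gamma> V \<rho> p x) t = k (1 / (\<gamma> - 1)) (0, 1)"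
    by (rule deriv_time_slice[OF De])
  have eq2: "divergence (\<lambda>y. enthalpy_density \<gamma> V \<rho> p y t *\<^sub>R V y t) x
      = enthalpy_density \<gamma> V \<rho> p x t * ?d + k (\<gamma> / (\<gamma> - 1)) (V x t, 0)"
    by (rule divergence_scaleR[OF has_derivative_space_slice[OF Dh] has_derivative_space_slice[OF DV]])
  have "\<gamma> / (\<gamma> - 1) = 1 / (\<gamma> - 1) + 1" using \<gamma> by (simp add: field_simps)
  then have eq3: "k (\<gamma> / (\<gamma> - 1)) (V x t, 0) = k (1 / (\<gamma> - 1)) (V x t, 0) + Dp (V x t, 0)"
    by (simp add: k_def distrib_right)
  have eq4: "k (1 / (\<gamma> - 1)) (0, 1) + k (1 / (\<gamma> - 1)) (V x t, 0) = k (1 / (\<gamma> - 1)) (V x t, 1)"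
    using linear_add[OF lin, of "1 / (\<gamma> - 1)" "(0, 1)" "(V x t, 0)"] by simp
  have eq5: "k (1 / (\<gamma> - 1)) (V x t, 1)
      = - Dp (V x t, 0) - 1/2 * \<rho> x t * ?d * (norm (V x t))\<^sup>2 - \<gamma> / (\<gamma> - 1) * p x t * ?d"
    using mom[of "V x t"] unfolding k_def mass press
    by (simp add: power2_norm_eq_inner algebra_simps)
  show ?thesis
    using eq1 eq2 eq3 eq4 eq5 unfolding enthalpy_density_def by (simp add: algebra_simps)
qed

text \<open>
  Pairing the momentum equation with \<open>x\<close>: since \<open>x\<close> has material derivative \<open>V\<close> and
  divergence \<open>n\<close>, the virial sources \<open>\<rho>|V|\<^sup>2\<close> and \<open>n p\<close> appear.
\<close>

lemma euler_virial_law: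
  fixes V :: "real^'n \<Rightarrow> real \<Rightarrow> real^'n"
  assumes sol: "global_classical_euler_solution \<gamma> V \<rho> p S" and \<gamma>: "\<gamma> > 1" and t: "t > 0"
  shows "deriv (\<lambda>s. \<rho> x s * (V x s \<bullet> x)) t
    + divergence (\<lambda>y. (\<rho> y t * (V y t \<bullet> y)) *\<^sub>R V y t + p y t *\<^sub>R y) x
    = \<rho> x t * (norm (V x t))\<^sup>2 + real CARD('n) * p x t"
proof -
  obtain DV D\<rho> Dp where DV: "((\<lambda>(y, s). V y s) has_derivative DV) (at (x, t))"
    and D\<rho>: "((\<lambda>(y, s). \<rho> y s) has_derivative D\<rho>) (at (x, t))"
    and Dp: "((\<lambda>(y, s). p y s) has_derivative Dp) (at (x, t))"
    and mass: "D\<rho> (V x t, 1) = - \<rho> x t * divergence (\<lambda>y. V y t) x"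
    and mom: "\<And>h. \<rho> x t * (h \<bullet> DV (V x t, 1)) = - Dp (h, 0)"
    and press: "Dp (V x t, 1) = - \<gamma> * p x t * divergence (\<lambda>y. V y t) x"
    by (rule euler_material_form[OF sol \<gamma> t, of x]) (rule that; assumption)
  define k where "k h = \<rho> x t * (V x t \<bullet> fst h + DV h \<bullet> x) + D\<rho> h * (V x t \<bullet> x)" for h
  have D: "((\<lambda>(y, s). \<rho> y s * (V y s \<bullet> y)) has_derivative k) (at (x, t))"
  proof -
    have "((\<lambda>z. (case z of (y, s) \<Rightarrow> \<rho> y s) * ((case z of (y, s) \<Rightarrow> V y s) \<bullet> fst z)) has_derivative k) (at (x, t))"
      by (rule derivative_eq_intros DV D\<rho> Dp refl)+ (auto simp: k_def fun_eq_iff algebra_simps)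
    then show ?thesis by (simp add: split_def)
  qed
  let ?d = "divergence (\<lambda>y. V y t) x"
  have eq1: "deriv (\<lambda>s. \<rho> x s * (V x s \<bullet> x)) t = k (0, 1)"
    by (rule deriv_time_slice[OF D])
  note qx = has_derivative_space_slice[OF D] and Vx = has_derivative_space_slice[OF DV]
    and px = has_derivative_space_slice[OF Dp]
  have eq2: "divergence (\<lambda>y. (\<rho> y t * (V y t \<bullet> y)) *\<^sub>R V y t + p y t *\<^sub>R y) x
      = (\<rho> x t * (V x t \<bullet> x) * ?d + k (V x t, 0)) + (p x t * real CARD('n) + Dp (x, 0))"
    using divergence_add[OF has_derivative_scaleR[OF qx Vx] has_derivative_scaleR[OF px has_derivative_ident]]
      divergence_scaleR[OF qx Vx] divergence_scaleR[OF px has_derivative_ident]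
    by (simp only: divergence_id)
  have eq4: "k (0, 1) + k (V x t, 0) = k (V x t, 1)"
    using linear_add[OF has_derivative_linear[OF D], of "(0, 1)" "(V x t, 0)"] by simp
  have eq5: "k (V x t, 1) = \<rho> x t * (norm (V x t))\<^sup>2 - Dp (x, 0) - \<rho> x t * ?d * (V x t \<bullet> x)"
    using mom[of x] unfolding k_def mass
    by (simp add: power2_norm_eq_inner inner_commute algebra_simps)
  show ?thesis
    using eq1 eq2 eq4 eq5 by (simp add: algebra_simps)
qed

section \<open>Growth of the virial and failure of smoothness\<close>

lemma C1_on_const: "C1_on D (\<lambda>z::'a::euclidean_space. c)"
  by (rule C1_onI[where f' = "\<lambda>z h. 0"]) simp_all

lemmas C1_on_mult = C1_on_bilinear[OF bounded_bilinear_mult]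
  and C1_on_scaleR = C1_on_bilinear[OF bounded_bilinear_scaleR]
  and C1_on_inner = C1_on_bilinear[OF bounded_bilinear_inner]

text \<open>
  On one fixed annulus \<open>a < norm x < b\<close>, write \<open>J\<close> for the cut-off
  integral of \<open>\<rho> V \<bullet> x\<close>, and \<open>H\<close> for the integral of \<open>\<rho>\<close> against the potential. If the inequality
  failed with margin \<open>c > 0\<close>, the virial law would give \<open>J(t) \<ge> J(0) + c t\<close>: the source is at
  least \<open>\<delta>\<close> times the energy inside, which falls below its initial value by no more than what has
  flowed out, and the outflow together with the momentum flux through the annulus is what
  \<open>bound\<close> controls. But \<open>H' = - J\<close>, so \<open>H\<close> would become negative, while it is an integral of
  nonnegative functions. The total mass may be infinite; \<open>H\<close> is finite because of the cutoff.
\<close>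

lemma euler_cutoff_estimate:
  fixes V :: "real^'n \<Rightarrow> real \<Rightarrow> real^'n" and \<rho> p S :: "real^'n \<Rightarrow> real \<Rightarrow> real"
  assumes sol: "global_classical_euler_solution \<gamma> V \<rho> p S" and \<gamma>: "\<gamma> > 1"
    and \<delta>: "0 \<le> \<delta>" "\<delta> \<le> 2" "\<delta> \<le> real CARD('n) * (\<gamma> - 1)"
    and ab: "0 < a" "a < b"
    and bound: "\<And>x t. a < norm x \<Longrightarrow> norm x < b \<Longrightarrow> t \<ge> 0 \<Longrightarrow>
      norm x ^ CARD('n) * (\<delta> / norm x * integral {0..t} (\<lambda>\<tau>. enthalpy_density \<gamma> V \<rho> p x \<tau> * norm (V x \<tau>))
        + (\<rho> x t * (norm (V x t))\<^sup>2 + real CARD('n) * p x t)) \<le> M"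
  shows "\<delta> * (\<integral>x. radial_cutoff a b x * energy_density \<gamma> V \<rho> p x 0 \<partial>lborel)
    \<le> real CARD('n) * measure lborel (ball (0::real^'n) 1) * M"
proof (rule ccontr)
  let ?n = "CARD('n)" and ?D = "UNIV \<times> {0..} :: ((real^'n) \<times> real) set"
  let ?\<omega> = "measure lborel (ball (0::real^'n) 1)"
  let ?e = "energy_density \<gamma> V \<rho> p" and ?h = "enthalpy_density \<gamma> V \<rho> p"
  define \<phi> where "\<phi> = (radial_cutoff a b :: real^'n \<Rightarrow> real)"
  define g where "g = (radial_cutoff_gradient a b :: real^'n \<Rightarrow> real^'n)"
  define \<Psi> where "\<Psi> = (radial_potential a b :: real^'n \<Rightarrow> real)"
  define A where "A = {x::real^'n. a < norm x \<and> norm x < b}"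
  define \<kappa> where "\<kappa> = real ?n / (b ^ ?n - a ^ ?n)"
  define w where "w x = indicator A x * (\<kappa> * norm x ^ (?n - 1))" for x :: "real^'n"
  define s where "s x t = \<rho> x t * (norm (V x t))\<^sup>2 + real ?n * p x t" for x t
  define c where "c = \<delta> * (\<integral>x. \<phi> x * ?e x 0 \<partial>lborel) - real ?n * ?\<omega> * M"
  assume "\<not> ?thesis"
  then have c: "c > 0" by (simp add: c_def \<phi>_def)
  have state: "\<rho> x t \<ge> 0" "p x t \<ge> 0" if "t \<ge> 0" for x t
    using sol that unfolding global_classical_euler_solution_def by simp_all
  have C1: "C1_on ?D (\<lambda>(x, t). V x t)" "C1_on ?D (\<lambda>(x, t). \<rho> x t)" "C1_on ?D (\<lambda>(x, t). p x t)"
    using sol unfolding global_classical_euler_solution_def by blast+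
  note C1' = C1[unfolded split_def]
  have "C1_on ?D (\<lambda>z. fst z)" by (rule C1_on_bounded_linear[OF bounded_linear_fst])
  note C1i = C1_on_add C1_on_mult C1_on_scaleR C1_on_inner C1_on_const C1' this
  have C1c: "C1_on ?D (\<lambda>(x, t). 1/2 * \<rho> x t * (norm (V x t))\<^sup>2 + k * p x t)" for k
    unfolding split_def power2_norm_eq_inner by (intro C1i)
  have C1e: "C1_on ?D (\<lambda>(x, t). ?e x t)" and C1h: "C1_on ?D (\<lambda>(x, t). ?h x t)"
    unfolding energy_density_def enthalpy_density_def by (rule C1c)+
  have C1hV: "C1_on ?D (\<lambda>(x, t). ?h x t *\<^sub>R V x t)"
    using C1_on_scaleR[OF C1h C1(1)] by (simp add: split_def)
  have C1q: "C1_on ?D (\<lambda>(x, t). \<rho> x t * (V x t \<bullet> x))" unfolding split_def by (intro C1i)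
  have C1F: "C1_on ?D (\<lambda>(x, t). (\<rho> x t * (V x t \<bullet> x)) *\<^sub>R V x t + p x t *\<^sub>R x)"
    unfolding split_def by (intro C1i)
  have C1m: "C1_on ?D (\<lambda>(x, t). \<rho> x t *\<^sub>R V x t)" unfolding split_def by (intro C1i)
  have C1s: "C1_on ?D (\<lambda>(x, t). s x t)"
    unfolding s_def split_def power2_norm_eq_inner by (intro C1i)
  have chV: "continuous_on ?D (\<lambda>(x, t). ?h x t * norm (V x t))"
    using C1_on_continuous[OF C1h] C1_on_continuous[OF C1(1)] unfolding split_def
    by (intro continuous_intros)
  note slice = continuous_on_slice[OF C1_on_continuous]

  have \<phi>cut: "lipschitz_cutoff b \<phi> g" unfolding \<phi>_def g_def by (rule lipschitz_cutoff_radial[OF ab])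
  have \<Psi>cut: "lipschitz_cutoff b \<Psi> (\<lambda>x. - \<phi> x *\<^sub>R x)"
    unfolding \<phi>_def \<Psi>_def by (rule lipschitz_cutoff_potential[OF ab])
  have \<phi>0: "\<phi> x \<ge> 0" for x
    using cutoff_profile_props(2)[OF ab] by (simp add: \<phi>_def radial_cutoff_def)
  have pos: "b ^ ?n - a ^ ?n > 0" using cutoff_profile_props(1)[OF ab, of ?n] by simp
  then have \<kappa>: "\<kappa> > 0" by (simp add: \<kappa>_def)
  have g: "g x = - w x *\<^sub>R sgn x" for x
    by (simp add: g_def radial_cutoff_gradient_def w_def A_def \<kappa>_def)
  have w0: "w x \<ge> 0" for x using \<kappa> by (simp add: w_def)
  have wm: "w \<in> borel_measurable borel" unfolding w_def[abs_def] A_def by measurable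
  have wb: "\<bar>w x\<bar> \<le> \<kappa> * b ^ (?n - 1)" for x
    using \<kappa> ab by (auto simp: w_def A_def indicator_def abs_mult intro!: mult_left_mono power_mono)
  have wz: "w x = 0" if "norm x \<ge> b" for x using that by (simp add: w_def A_def)
  have wi: "integrable lborel (\<lambda>x. w x * f x)" if "continuous_on UNIV f" for f
    by (rule integrable_cutoff_mult[OF wm wb wz that])
  define P where "P x t = integral {0..t} (\<lambda>\<tau>. ?h x \<tau> * norm (V x \<tau>))" for x t
  have e0: "0 \<le> ?h x t" if "t \<ge> 0" for x t
    using state[OF that, of x] \<gamma> by (simp add: enthalpy_density_def)
  have se: "\<delta> * ?e x t \<le> s x t" if "t \<ge> 0" for x t
  proof -
    have "\<delta> * (1/2 * \<rho> x t * (norm (V x t))\<^sup>2) \<le> 2 * (1/2 * \<rho> x t * (norm (V x t))\<^sup>2)"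
      using state[OF that, of x] \<delta> by (intro mult_right_mono) auto
    moreover have "\<delta> * (1 / (\<gamma> - 1) * p x t) \<le> real ?n * (\<gamma> - 1) * (1 / (\<gamma> - 1) * p x t)"
      using state[OF that, of x] \<delta> \<gamma> by (intro mult_right_mono) auto
    ultimately show ?thesis using \<gamma> by (simp add: energy_density_def s_def distrib_left)
  qed

  \<comment> \<open>energy lost from the cut-off region is at most the time integral of the outward enthalpy flux\<close>
  have energy: "(\<integral>x. \<phi> x * ?e x 0 \<partial>lborel) - (\<integral>x. w x * P x t \<partial>lborel) \<le> (\<integral>x. \<phi> x * ?e x t \<partial>lborel)"
    if t: "t \<ge> 0" for t
  proof -
    have "((\<lambda>\<tau>. (\<integral>x. \<phi> x * 0 \<partial>lborel) + (\<integral>x. g x \<bullet> (?h x \<tau> *\<^sub>R V x \<tau>) \<partial>lborel)) has_integral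
        (\<integral>x. \<phi> x * ?e x t \<partial>lborel) - (\<integral>x. \<phi> x * ?e x 0 \<partial>lborel)) {0..t}"
      by (rule cutoff_conservation_law[OF \<phi>cut C1e C1hV _ _ t]) (use euler_energy_law[OF sol \<gamma>] in auto)
    then have 1: "((\<lambda>\<tau>. \<integral>x. g x \<bullet> (?h x \<tau> *\<^sub>R V x \<tau>) \<partial>lborel) has_integral
        (\<integral>x. \<phi> x * ?e x t \<partial>lborel) - (\<integral>x. \<phi> x * ?e x 0 \<partial>lborel)) {0..t}" by simp
    have 2: "((\<lambda>\<tau>. - (\<integral>x. w x * (?h x \<tau> * norm (V x \<tau>)) \<partial>lborel)) has_integral
        - (\<integral>x. w x * P x t \<partial>lborel)) {0..t}"
      unfolding P_def by (intro has_integral_neg cutoff_integral_time_swap(2)[OF wm wb wz chV])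
    have "- (\<integral>x. w x * (?h x \<tau> * norm (V x \<tau>)) \<partial>lborel) \<le> (\<integral>x. g x \<bullet> (?h x \<tau> *\<^sub>R V x \<tau>) \<partial>lborel)"
      if \<tau>: "\<tau> \<in> {0..t}" for \<tau>
    proof -
      have "(\<integral>x. - (w x * (?h x \<tau> * norm (V x \<tau>))) \<partial>lborel) \<le> (\<integral>x. g x \<bullet> (?h x \<tau> *\<^sub>R V x \<tau>) \<partial>lborel)"
      proof (rule integral_mono)
        show "integrable lborel (\<lambda>x. - (w x * (?h x \<tau> * norm (V x \<tau>))))"
          using \<tau> by (intro Bochner_Integration.integrable_minus wi continuous_on_slice[OF chV]) auto
        show "integrable lborel (\<lambda>x. g x \<bullet> (?h x \<tau> *\<^sub>R V x \<tau>))"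
          using \<tau> by (intro lipschitz_cutoff_integrable(2)[OF \<phi>cut] slice[OF C1hV]) auto
        show "- (w x * (?h x \<tau> * norm (V x \<tau>))) \<le> g x \<bullet> (?h x \<tau> *\<^sub>R V x \<tau>)" for x
        proof -
          have "sgn x \<bullet> V x \<tau> \<le> norm (V x \<tau>)"
            using norm_cauchy_schwarz[of "sgn x" "V x \<tau>"] mult_right_mono[of "norm (sgn x)" 1 "norm (V x \<tau>)"]
            by (simp add: norm_sgn split: if_splits)
          then have "w x * ?h x \<tau> * (sgn x \<bullet> V x \<tau>) \<le> w x * ?h x \<tau> * norm (V x \<tau>)"
            using w0 e0[of \<tau> x] \<tau> by (intro mult_left_mono) auto
          then show ?thesis by (simp add: g algebra_simps)
        qed
      qed
      then show ?thesis by simp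
    qed
    from has_integral_le[OF 2 1 this] show ?thesis by simp
  qed

  have force: "c \<le> (\<integral>x. \<phi> x * s x t \<partial>lborel)
      + (\<integral>x. g x \<bullet> ((\<rho> x t * (V x t \<bullet> x)) *\<^sub>R V x t + p x t *\<^sub>R x) \<partial>lborel)" if t: "t \<ge> 0" for t
  proof -
    have i1: "integrable lborel (\<lambda>x. w x * P x t)"
      unfolding P_def by (rule cutoff_integral_time_swap(1)[OF wm wb wz chV])
    have i2: "integrable lborel (\<lambda>x. w x * (norm x * s x t))"
      by (intro wi continuous_intros slice[OF C1s] t)
    have "\<delta> * (\<integral>x. \<phi> x * ?e x t \<partial>lborel) = (\<integral>x. \<phi> x * (\<delta> * ?e x t) \<partial>lborel)"
      by (simp add: mult.left_commute)
    also have "\<dots> \<le> (\<integral>x. \<phi> x * s x t \<partial>lborel)"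
      using se[OF t] \<phi>0 t
      by (intro integral_mono lipschitz_cutoff_integrable(1)[OF \<phi>cut] continuous_intros slice[OF C1e] slice[OF C1s]
          mult_left_mono) auto
    finally have 1: "\<delta> * (\<integral>x. \<phi> x * ?e x t \<partial>lborel) \<le> (\<integral>x. \<phi> x * s x t \<partial>lborel)" .
    have "(\<integral>x. - (w x * (norm x * s x t)) \<partial>lborel)
        \<le> (\<integral>x. g x \<bullet> ((\<rho> x t * (V x t \<bullet> x)) *\<^sub>R V x t + p x t *\<^sub>R x) \<partial>lborel)"
    proof (rule integral_mono)
      show "integrable lborel (\<lambda>x. - (w x * (norm x * s x t)))" using i2 by simp
      show "integrable lborel (\<lambda>x. g x \<bullet> ((\<rho> x t * (V x t \<bullet> x)) *\<^sub>R V x t + p x t *\<^sub>R x))"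
        by (rule lipschitz_cutoff_integrable(2)[OF \<phi>cut slice[OF C1F t]])
      show "- (w x * (norm x * s x t)) \<le> g x \<bullet> ((\<rho> x t * (V x t \<bullet> x)) *\<^sub>R V x t + p x t *\<^sub>R x)" for x
      proof -
        have sx: "sgn x \<bullet> x = norm x" by (cases "x = 0") (simp_all add: sgn_div_norm dot_square_norm power2_eq_square)
        have x: "x = norm x *\<^sub>R sgn x" by (cases "x = 0") (simp_all add: sgn_div_norm)
        have "(V x t \<bullet> x) * (sgn x \<bullet> V x t) = norm x * (sgn x \<bullet> V x t)\<^sup>2"
          by (subst (1) x) (simp add: power2_eq_square inner_commute)
        also have "\<dots> \<le> norm x * (norm (V x t))\<^sup>2"
        proof (intro mult_left_mono)
          have "\<bar>sgn x \<bullet> V x t\<bar> \<le> norm (V x t)"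
            using Cauchy_Schwarz_ineq2[of "sgn x" "V x t"] by (simp add: norm_sgn split: if_splits)
          then show "(sgn x \<bullet> V x t)\<^sup>2 \<le> (norm (V x t))\<^sup>2" by (simp add: power2_le_iff_abs_le)
        qed simp
        finally have "\<rho> x t * ((V x t \<bullet> x) * (sgn x \<bullet> V x t)) \<le> \<rho> x t * (norm x * (norm (V x t))\<^sup>2)"
          using state[OF t] by (intro mult_left_mono) auto
        moreover have "p x t * norm x \<le> real ?n * p x t * norm x"
          using state(2)[OF t, of x] mult_right_mono[of 1 "real ?n" "p x t"]
          by (intro mult_right_mono) (auto simp: Suc_le_eq)
        ultimately have "\<rho> x t * ((V x t \<bullet> x) * (sgn x \<bullet> V x t)) + p x t * norm x \<le> norm x * s x t"
          by (simp add: s_def algebra_simps)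
        from mult_left_mono[OF this w0[of x]] show ?thesis
          by (simp add: g inner_add_right sx algebra_simps)
      qed
    qed
    then have 2: "- (\<integral>x. w x * (norm x * s x t) \<partial>lborel)
        \<le> (\<integral>x. g x \<bullet> ((\<rho> x t * (V x t \<bullet> x)) *\<^sub>R V x t + p x t *\<^sub>R x) \<partial>lborel)" by simp
    have "\<delta> * (\<integral>x. w x * P x t \<partial>lborel) + (\<integral>x. w x * (norm x * s x t) \<partial>lborel)
        = (\<integral>x. \<delta> * (w x * P x t) + w x * (norm x * s x t) \<partial>lborel)"
      using i1 i2 by simp
    also have "\<dots> \<le> (\<integral>x. \<kappa> * M * indicator A x \<partial>lborel)"
    proof (rule integral_mono)
      show "integrable lborel (\<lambda>x. \<delta> * (w x * P x t) + w x * (norm x * s x t))" using i1 i2 by simp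
      show "integrable lborel (\<lambda>x. \<kappa> * M * indicator A x)"
        unfolding A_def by (rule integral_radial_annulus(1)[OF ab])
      show "\<delta> * (w x * P x t) + w x * (norm x * s x t) \<le> \<kappa> * M * indicator A x" for x
      proof (cases "x \<in> A")
        case True
        then have x: "a < norm x" "norm x < b" by (auto simp: A_def)
        then have nx: "norm x > 0" using ab by linarith
        have pw: "norm x ^ ?n = norm x * norm x ^ (?n - 1)"
          using power_minus_mult[of ?n "norm x"] by (simp add: mult.commute)
        \<comment> \<open>pulling out a factor \<open>norm x\<close> turns the weight of the annulus into the power of \<open>norm x\<close> in \<open>bound\<close>\<close>
        have "norm x ^ (?n - 1) * (\<delta> * P x t + norm x * s x t)
            = norm x ^ ?n * (\<delta> / norm x * P x t + s x t)"
          unfolding pw using nx by (simp add: field_simps)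
        also have "\<dots> \<le> M" using bound[OF x t] by (simp add: P_def s_def)
        finally have "\<kappa> * (norm x ^ (?n - 1) * (\<delta> * P x t + norm x * s x t)) \<le> \<kappa> * M"
          using \<kappa> by (intro mult_left_mono) auto
        then show ?thesis using True by (simp add: w_def algebra_simps)
      qed (simp add: w_def)
    qed
    also have "\<dots> = real ?n * ?\<omega> * M"
      using integral_radial_annulus(2)[OF ab, where 'a = "real^'n", of "\<kappa> * M"] pos
      by (simp add: A_def \<kappa>_def)
    finally have 3: "\<delta> * (\<integral>x. w x * P x t \<partial>lborel) + (\<integral>x. w x * (norm x * s x t) \<partial>lborel) \<le> real ?n * ?\<omega> * M" .
    have "\<delta> * ((\<integral>x. \<phi> x * ?e x 0 \<partial>lborel) - (\<integral>x. w x * P x t \<partial>lborel)) \<le> \<delta> * (\<integral>x. \<phi> x * ?e x t \<partial>lborel)"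
      by (rule mult_left_mono[OF energy[OF t] \<delta>(1)])
    with 1 2 3 show ?thesis by (simp add: c_def right_diff_distrib)
  qed

  define J where "J t = (\<integral>x. \<phi> x * (\<rho> x t * (V x t \<bullet> x)) \<partial>lborel)" for t
  have J: "J 0 + c * t \<le> J t" if t: "t \<ge> 0" for t
  proof -
    have 1: "((\<lambda>\<tau>. (\<integral>x. \<phi> x * s x \<tau> \<partial>lborel)
        + (\<integral>x. g x \<bullet> ((\<rho> x \<tau> * (V x \<tau> \<bullet> x)) *\<^sub>R V x \<tau> + p x \<tau> *\<^sub>R x) \<partial>lborel)) has_integral J t - J 0) {0..t}"
      unfolding J_def
      by (rule cutoff_conservation_law[OF \<phi>cut C1q C1F C1_on_continuous[OF C1s] _ t])
        (use euler_virial_law[OF sol \<gamma>] in \<open>simp add: s_def\<close>)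
    have 2: "((\<lambda>\<tau>. c) has_integral c * t) {0..t}"
      using has_integral_const_real[of c 0 t] t by (simp add: mult.commute)
    from has_integral_le[OF 2 1] force show ?thesis by simp
  qed

  define H where "H t = (\<integral>x. \<Psi> x * \<rho> x t \<partial>lborel)" for t
  have H0: "H t \<ge> 0" if "t \<ge> 0" for t
    unfolding H_def \<Psi>_def using state(1)[OF that] radial_potential_nonneg[OF ab]
    by (intro Bochner_Integration.integral_nonneg mult_nonneg_nonneg) auto
  have H: "H t \<le> H 0 - J 0 * t - c * t\<^sup>2 / 2" if t: "t \<ge> 0" for t
  proof -
    have "((\<lambda>\<tau>. (\<integral>x. \<Psi> x * 0 \<partial>lborel) + (\<integral>x. (- \<phi> x *\<^sub>R x) \<bullet> (\<rho> x \<tau> *\<^sub>R V x \<tau>) \<partial>lborel))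
        has_integral H t - H 0) {0..t}"
      unfolding H_def
      by (rule cutoff_conservation_law[OF \<Psi>cut C1(2) C1m _ _ t])
        (use sol in \<open>auto simp: global_classical_euler_solution_def\<close>)
    moreover have "(\<integral>x. (- \<phi> x *\<^sub>R x) \<bullet> (\<rho> x \<tau> *\<^sub>R V x \<tau>) \<partial>lborel) = - J \<tau>" for \<tau>
      unfolding J_def Bochner_Integration.integral_minus[symmetric]
      by (intro Bochner_Integration.integral_cong refl) (simp add: inner_commute)
    ultimately have 1: "((\<lambda>\<tau>. - J \<tau>) has_integral H t - H 0) {0..t}" by simp
    have 2: "((\<lambda>\<tau>. - J 0 - c * \<tau>) has_integral (- J 0 * t - c * t\<^sup>2 / 2) - (- J 0 * 0 - c * 0\<^sup>2 / 2)) {0..t}"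
      by (rule fundamental_theorem_of_calculus[OF t])
        (auto intro!: derivative_eq_intros simp flip: has_real_derivative_iff_has_vector_derivative)
    have "- J \<tau> \<le> - J 0 - c * \<tau>" if "\<tau> \<in> {0..t}" for \<tau> using J[of \<tau>] that by simp
    from has_integral_le[OF 1 2 this] show ?thesis by simp
  qed
  \<comment> \<open>for \<open>t \<ge> 1\<close> the upper bound for \<open>H t\<close> is at most \<open>t (H 0 + \<bar>J 0\<bar> - c t / 2)\<close>\<close>
  define T where "T = 1 + 2 * (H 0 + \<bar>J 0\<bar>) / c"
  have H00: "H 0 \<ge> 0" by (rule H0) simp
  then have T: "T \<ge> 1" using c by (simp add: T_def)
  have "H 0 \<le> H 0 * T" using T H00 mult_left_mono[of 1 T "H 0"] by simp
  moreover have "- J 0 * T \<le> \<bar>J 0\<bar> * T" using T by (intro mult_right_mono) auto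
  moreover have "c * T = c + 2 * (H 0 + \<bar>J 0\<bar>)" using c by (simp add: T_def field_simps)
  then have "c * T * T / 2 = (c + 2 * (H 0 + \<bar>J 0\<bar>)) * T / 2" by simp
  then have "c * T\<^sup>2 / 2 = c / 2 * T + H 0 * T + \<bar>J 0\<bar> * T"
    by (simp add: power2_eq_square mult.assoc distrib_right add_divide_distrib)
  moreover have "c / 2 * T > 0" using c T by simp
  ultimately have "H 0 - J 0 * T - c * T\<^sup>2 / 2 < 0" by linarith
  with H[of T] H0[of T] T show False by simp
qed

theorem theorem1p1:
  fixes V :: "real^'n \<Rightarrow> real \<Rightarrow> real^'n"
    and \<rho> p S :: "real^'n \<Rightarrow> real \<Rightarrow> real"
    and V\<^sub>0 :: "real^'n \<Rightarrow> real^'n"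
    and \<rho>\<^sub>0 p\<^sub>0 :: "real^'n \<Rightarrow> real"
    and \<gamma> \<delta> \<delta>\<^sub>1 \<omega> E :: real
    and L :: ereal
  assumes gamma: "\<gamma> > 1"
    and delta: "\<delta> = min 2 (real CARD('n) * (\<gamma> - 1))"
    and omega: "\<omega> = measure lborel (ball (0 :: real^'n) 1)"
    and data_C1: "C1_on UNIV V\<^sub>0" "C1_on UNIV \<rho>\<^sub>0" "C1_on UNIV p\<^sub>0"
    and data_nonneg: "\<And>x. \<rho>\<^sub>0 x \<ge> 0" "\<And>x. p\<^sub>0 x \<ge> 0"
    and initial: "\<And>x. V x 0 = V\<^sub>0 x" "\<And>x. \<rho> x 0 = \<rho>\<^sub>0 x" "\<And>x. p x 0 = p\<^sub>0 x"
    and energy: "E > 0" "\<And>t. t \<ge> 0 \<Longrightarrow> finite_energy V \<rho> p t"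
      "\<And>t. t \<ge> 0 \<Longrightarrow> total_energy \<gamma> V \<rho> p t = E"
    and delta1: "0 \<le> \<delta>\<^sub>1" "\<delta>\<^sub>1 < \<delta> / (real CARD('n) * \<omega>)"
    and decay:
      "((\<lambda>R. ereal (R ^ CARD('n)) *
          (SUP (x, t) \<in> sphere 0 R \<times> {0..}. ereal (
             \<delta> / R * integral {0..t} (\<lambda>\<tau>.
                (1/2 * \<rho> x \<tau> * (norm (V x \<tau>))\<^sup>2 + \<gamma> / (\<gamma> - 1) * p x \<tau>) * norm (V x \<tau>))
             + (\<rho> x t * (norm (V x t))\<^sup>2 + real CARD('n) * p x t))))
        \<longlongrightarrow> L) at_top"
      "L \<le> ereal (\<delta>\<^sub>1 * E)"
  shows "\<not> global_classical_euler_solution \<gamma> V \<rho> p S"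
proof
  assume sol: "global_classical_euler_solution \<gamma> V \<rho> p S"
  let ?n = "real CARD('n)"
  define Q where "Q x t = \<delta> / norm x * integral {0..t} (\<lambda>\<tau>. enthalpy_density \<gamma> V \<rho> p x \<tau> * norm (V x \<tau>))
      + (\<rho> x t * (norm (V x t))\<^sup>2 + ?n * p x t)" for x t
  have \<omega>: "\<omega> > 0" unfolding omega by simp
  have \<delta>: "0 < \<delta>" "\<delta> \<le> 2" "\<delta> \<le> ?n * (\<gamma> - 1)" using gamma by (auto simp: delta)
  have gap: "\<delta>\<^sub>1 * E < \<delta> * E / (?n * \<omega>)"
    using mult_strict_right_mono[OF delta1(2) energy(1)] by simp
  obtain M where M: "\<delta>\<^sub>1 * E < M" "M < \<delta> * E / (?n * \<omega>)" using dense[OF gap] by blast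
  have nM: "?n * \<omega> * M < \<delta> * E"
    using M(2) \<omega> by (simp add: less_divide_eq mult.commute)

  have "L < ereal M" using decay(2) M(1) by (auto intro: le_less_trans)
  \<comment> \<open>the scaled supremum is eventually below \<open>M\<close>, in particular finite, at all large radii\<close>
  from order_tendstoD(2)[OF decay(1) this]
  obtain R0 where R0: "\<And>R. R \<ge> R0 \<Longrightarrow> ereal (R ^ CARD('n)) *
          (SUP (x, t) \<in> sphere 0 R \<times> {0..}. ereal (
             \<delta> / R * integral {0..t} (\<lambda>\<tau>.
                (1/2 * \<rho> x \<tau> * (norm (V x \<tau>))\<^sup>2 + \<gamma> / (\<gamma> - 1) * p x \<tau>) * norm (V x \<tau>))
             + (\<rho> x t * (norm (V x t))\<^sup>2 + real CARD('n) * p x t))) < ereal M"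
    unfolding eventually_at_top_linorder by blast
  have bound: "norm x ^ CARD('n) * Q x t \<le> M" if x: "norm x \<ge> R0" and t: "t \<ge> 0" for x t
  proof -
    have "ereal (Q x t) \<le> (SUP (x', t) \<in> sphere 0 (norm x) \<times> {0..}. ereal (
             \<delta> / norm x * integral {0..t} (\<lambda>\<tau>.
                (1/2 * \<rho> x' \<tau> * (norm (V x' \<tau>))\<^sup>2 + \<gamma> / (\<gamma> - 1) * p x' \<tau>) * norm (V x' \<tau>))
             + (\<rho> x' t * (norm (V x' t))\<^sup>2 + real CARD('n) * p x' t)))"
      by (rule SUP_upper2[of "(x, t)"]) (use t in \<open>auto simp: Q_def enthalpy_density_def\<close>)
    then have "ereal (norm x ^ CARD('n)) * ereal (Q x t) < ereal M"
      by (intro le_less_trans[OF ereal_mult_left_mono R0[OF x]]) auto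
    then show ?thesis by simp
  qed

  \<comment> \<open>cutoffs equal to \<open>1\<close> on growing balls, with all transition annuli in the region of the decay bound\<close>
  define a where "a k = max R0 0 + 1 + real k" for k
  have a: "0 < a k" "R0 \<le> a k" for k by (auto simp: a_def)
  define e where "e x = energy_density \<gamma> V \<rho> p x 0" for x
  have fin: "integrable lborel (\<lambda>x. \<rho> x 0 * (norm (V x 0))\<^sup>2)" "integrable lborel (\<lambda>x. p x 0)"
    using energy(2)[of 0] by (auto simp: finite_energy_def)
  have ei: "integrable lborel e"
    unfolding e_def[abs_def] energy_density_def mult.assoc
    by (intro Bochner_Integration.integrable_add integrable_mult_right fin)
  have eE: "(\<integral>x. e x \<partial>lborel) = E"
    using energy(3)[of 0] fin by (simp add: e_def energy_density_def total_energy_def mult.assoc)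
  have em: "e \<in> borel_measurable borel" using ei by simp
  have "(\<lambda>k. \<integral>x. radial_cutoff (a k) (a k + 1) x * e x \<partial>lborel) \<longlonglongrightarrow> (\<integral>x. e x \<partial>lborel)"
  proof (rule integral_dominated_convergence)
    show "e \<in> borel_measurable lborel" using em by simp
    show "integrable lborel (\<lambda>x. norm (e x))" using ei by simp
    show "(\<lambda>x. radial_cutoff (a k) (a k + 1) x * e x) \<in> borel_measurable lborel" for k
      using lipschitz_cutoffD(3)[OF lipschitz_cutoff_radial[OF a(1), of k "a k + 1"]] em
      by (intro borel_measurable_times) simp_all
    show "AE x in lborel. norm (radial_cutoff (a k) (a k + 1) x * e x) \<le> norm (e x)" for k
    proof (rule AE_I2)
      fix x :: "real^'n"
      have "\<bar>radial_cutoff (a k) (a k + 1) x\<bar> \<le> 1"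
        using cutoff_profile_props(2,3)[OF a(1), of k "a k + 1"] by (simp add: radial_cutoff_def)
      then show "norm (radial_cutoff (a k) (a k + 1) x * e x) \<le> norm (e x)"
        by (simp add: abs_mult mult_left_le_one_le)
    qed
    show "AE x in lborel. (\<lambda>k. radial_cutoff (a k) (a k + 1) x * e x) \<longlonglongrightarrow> e x"
    proof (rule AE_I2)
      fix x :: "real^'n"
      obtain k0 where k0: "norm x \<le> real k0" using real_arch_simple by blast
      have "radial_cutoff (a k) (a k + 1) x * e x = e x" if "k \<ge> k0" for k
        using cutoff_profile_props(4)[OF a(1), of k "a k + 1" "DIM(real^'n)" "norm x"] k0 that
        by (simp add: radial_cutoff_def a_def)
      then show "(\<lambda>k. radial_cutoff (a k) (a k + 1) x * e x) \<longlonglongrightarrow> e x"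
        by (intro tendsto_eventually eventually_sequentiallyI)
    qed
  qed
  then have "(\<lambda>k. \<delta> * (\<integral>x. radial_cutoff (a k) (a k + 1) x * e x \<partial>lborel)) \<longlonglongrightarrow> \<delta> * E"
    unfolding eE by (rule tendsto_mult_left)
  moreover have "\<delta> * (\<integral>x. radial_cutoff (a k) (a k + 1) x * e x \<partial>lborel) \<le> ?n * \<omega> * M" for k
    unfolding e_def omega
  proof (rule euler_cutoff_estimate[OF sol gamma _ \<delta>(2,3) a(1)])
    show "norm x ^ CARD('n) * (\<delta> / norm x *
          integral {0..t} (\<lambda>\<tau>. enthalpy_density \<gamma> V \<rho> p x \<tau> * norm (V x \<tau>))
        + (\<rho> x t * (norm (V x t))\<^sup>2 + ?n * p x t)) \<le> M"
      if "a k < norm x" "0 \<le> t" for x t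
      using bound[of x t] that a(2)[of k] unfolding Q_def by simp
  qed (use \<delta>(1) in simp_all)
  ultimately have "\<delta> * E \<le> ?n * \<omega> * M" by (intro LIMSEQ_le_const2) auto
  with nM show False by simp
qed

end
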